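(* Let $m,n>-1/2$, $\alpha_1,\alpha_2>0$, let $X\sim\mathrm{VG}(m,\alpha_1,0,0)$ and $Y\sim\mathrm{VG}(n,\alpha_2,0,0)$ be independent and $Z=XY$. Then for all $t\in\mathbb{R}\setminus\{0\}$, \[ \varphi_Z(t)=\frac{\alpha_1\alpha_2}{2\sqrt\pi\,\Gamma(m+1/2)\Gamma(n+1/2)}|t|^{-1}G^{3,1}_{1,3}\bigg(\frac{\alpha_1^2\alpha_2^2}{4t^2}\,\bigg|\,{\frac12\atop 0,m,n}\bigg)=\frac{1}{\sqrt\pi\,\Gamma(m+1/2)\Gamma(n+1/2)}G^{3,1}_{1,3}\bigg(\frac{\alpha_1^2\alpha_2^2}{4t^2}\,\bigg|\,{1\atop \frac12,m+\frac12,n+\frac12}\bigg). \]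
   Context: For $\mu>-1/2$, $\alpha>0$ and $0\le|\beta|<\alpha$, $\mathrm{VG}(\mu,\alpha,\beta,0)$ denotes the variance-gamma distribution on $\mathbb{R}$ with probability density function $f(x)=\frac{(\alpha^2-\beta^2)^{\mu+1/2}}{\sqrt{\pi}(2\alpha)^{\mu}\Gamma(\mu+1/2)}e^{\beta x}|x|^{\mu}K_{\mu}(\alpha|x|)$, where $K_\nu$ is the modified Bessel function of the second kind. $\varphi_Z(t)=\mathbb{E}[e^{\mathrm{i}tZ}]$. The Meijer $G$-function is defined by $G^{k,l}_{p,q}\big(x\,\big|\,{a_1,\dots,a_p\atop b_1,\dots,b_q}\big)=\frac{1}{2\pi\mathrm{i}}\int_L\frac{\prod_{j=1}^k\Gamma(b_j-s)\prod_{j=1}^l\Gamma(1-a_j+s)}{\prod_{j=l+1}^p\Gamma(a_j-s)\prod_{j=k+1}^q\Gamma(1-b_j+s)}x^s\,\mathrm{d}s$, where the path $L$ separates the poles of the $\Gamma(b_j-s)$ from those of the $\Gamma(1-a_j+s)$, and empty products are $1$. *)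

theory Defs
  imports "HOL-Probability.Probability"
begin

text \<open>Modified Bessel function of the second kind, for x > 0, via the standard
  integral representation K_nu(x) = int_0^infty exp(-x cosh t) cosh(nu t) dt (DLMF 10.32.9).\<close>
definition besselK :: "real \<Rightarrow> real \<Rightarrow> real" where
  "besselK \<nu> x = integral {0..} (\<lambda>t. exp (- x * cosh t) * cosh (\<nu> * t))"

definition vg_pdf :: "real \<Rightarrow> real \<Rightarrow> real \<Rightarrow> real \<Rightarrow> real" where
  "vg_pdf \<mu> \<alpha> \<beta> x =
     (\<alpha>\<^sup>2 - \<beta>\<^sup>2) powr (\<mu> + 1/2) / (sqrt pi * (2 * \<alpha>) powr \<mu> * Gamma (\<mu> + 1/2))
     * exp (\<beta> * x) * \<bar>x\<bar> powr \<mu> * besselK \<mu> (\<alpha> * \<bar>x\<bar>)"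

definition meijerG_integrand ::
  "nat \<Rightarrow> nat \<Rightarrow> real list \<Rightarrow> real list \<Rightarrow> real \<Rightarrow> complex \<Rightarrow> complex" where
  "meijerG_integrand k l as bs x s =
     ((\<Prod>j<k. Gamma (of_real (bs!j) - s)) * (\<Prod>j<l. Gamma (1 - of_real (as!j) + s)))
     / ((\<Prod>j\<in>{l..<length as}. Gamma (of_real (as!j) - s))
        * (\<Prod>j\<in>{k..<length bs}. Gamma (1 - of_real (bs!j) + s)))
     * (of_real x) powr s"

text \<open>Meijer G-function G^{k,l}_{p,q}(x | as; bs) for x > 0, with the contour L taken
  as the vertical line Re s = c, where c separates the poles of the Gamma(b_j - s),
  j < k (at s = b_j + N) from those of the Gamma(1 - a_j + s), j < l (at s = a_j - 1 - N).
  The factor 1/(2 pi i) combined with ds = i dy gives 1/(2 pi).\<close>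
definition meijerG ::
  "nat \<Rightarrow> nat \<Rightarrow> real list \<Rightarrow> real list \<Rightarrow> real \<Rightarrow> complex" where
  "meijerG k l as bs x =
     (let c = (SOME c::real. (\<forall>j<k. c < bs!j) \<and> (\<forall>j<l. as!j - 1 < c)) in
      integral UNIV (\<lambda>y::real. meijerG_integrand k l as bs x (Complex c y)) / (2 * pi))"

end

theory Submission
  imports Defs
begin

text \<open>A variance-gamma variable is a centred Gaussian with a gamma distributed variance. Hence
  conditioning on \<open>X\<close> gives \<open>E (exp (i t Z)) = E ((1 + W) powr - (n + 1/2))\<close> with
  \<open>W = (t X / \<alpha>2)^2\<close>. Writing \<open>(1 + w) powr - \<nu>\<close> as the Mellin-Barnes integral of
  \<open>Gamma s * Gamma (\<nu> - s) * w powr - s / Gamma \<nu>\<close> and exchanging it with the expectation leaves the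
  moments of \<open>X^2\<close> of order \<open>- s\<close>, which contribute \<open>Gamma (1/2 - s) * Gamma (m + 1/2 - s)\<close>. This
  is the second formula on every admissible line; moving the variable by 1/2 gives the first.\<close>

section \<open>Integrals in exponential coordinates\<close>

text \<open>Every exchange of integrals has to be absolutely convergent, yet the decay of a product
  of Gamma functions along a vertical line is never estimated. Quadratic decay of a single
  \<open>Gamma\<close> starts the argument. Each further factor enters as an inner integral, namely
  Euler's integral or a moment of X^2, and Fubini then yields integrability of the enlarged product
  together with its value. The same integrals dictate the admissible abscissas c:
  \<open>Gamma s\<close> asks for c > 0, the binomial formula for c < n + 1/2, the moments for c <
  1/2 and c < m + 1/2. This is exactly the strip that separates the poles in the second G-function,
  and m, n > -1/2 makes it nonempty.\<close>

lemma exp_image_UNIV: "range (exp :: real \<Rightarrow> real) = {0<..}"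
  by (auto simp: image_iff) (metis exp_ln)

text \<open>The change of variables theorem concerns the completed measure. Borel measurability of
  \<open>f\<close> is what carries both integrability and value back to
  \<open>lborel\<close>.\<close>

lemma
  fixes f :: "real \<Rightarrow> 'a::euclidean_space"
  assumes f[measurable]: "f \<in> borel_measurable borel"
  shows integrable_exp_substitution:
      "integrable lborel (\<lambda>u. exp u *\<^sub>R f (exp u)) \<longleftrightarrow> set_integrable lborel {0<..} f"
    and integral_exp_substitution:
      "set_integrable lborel {0<..} f \<Longrightarrow>
        (\<integral>u. exp u *\<^sub>R f (exp u) \<partial>lborel) = (LINT x:{0<..}|lborel. f x)"
proof -
  \<comment> \<open>This is an equivalence for every \<open>b\<close>. Choosing \<open>b\<close> as
    the integral on one side or the other separates integrability from the equality of
    values.\<close>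
  have cov: "(\<lambda>u. \<bar>exp u\<bar> *\<^sub>R f (exp u)) absolutely_integrable_on UNIV \<and>
      integral UNIV (\<lambda>u. \<bar>exp u\<bar> *\<^sub>R f (exp u)) = b
      \<longleftrightarrow> f absolutely_integrable_on range exp \<and> integral (range exp) f = b" for b
    by (intro has_absolute_integral_change_of_variables_real)
      (auto intro!: derivative_eq_intros simp: inj_on_def)
  have L: "(\<lambda>u. \<bar>exp u\<bar> *\<^sub>R f (exp u)) absolutely_integrable_on UNIV \<longleftrightarrow>
      integrable lborel (\<lambda>u. exp u *\<^sub>R f (exp u))"
    by (simp add: set_integrable_def integrable_completion)
  have R: "f absolutely_integrable_on range exp \<longleftrightarrow> set_integrable lborel {0<..} f"
    by (simp add: exp_image_UNIV set_integrable_def integrable_completion)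
  show iff: "integrable lborel (\<lambda>u. exp u *\<^sub>R f (exp u)) \<longleftrightarrow> set_integrable lborel {0<..} f"
    using cov L R by blast
  assume si: "set_integrable lborel {0<..} f"
  have "integral UNIV (\<lambda>u. \<bar>exp u\<bar> *\<^sub>R f (exp u)) = integral {0<..} f"
    using cov[of "integral {0<..} f"] R si exp_image_UNIV by auto
  then show "(\<integral>u. exp u *\<^sub>R f (exp u) \<partial>lborel) = (LINT x:{0<..}|lborel. f x)"
    using si iff by (simp add: integral_lborel set_borel_integral_eq_integral)
qed

lemma has_bochner_integral_translate:
  fixes f :: "real \<Rightarrow> 'a::{banach, second_countable_topology}"
  assumes "has_bochner_integral lborel f I"
  shows "has_bochner_integral lborel (\<lambda>u. f (t + u)) I"
  using assms lborel_has_bochner_integral_real_affine_iff[of 1 f I t] by simp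

lemma of_real_powr_eq_exp:
  "x > 0 \<Longrightarrow> complex_of_real x powr z = exp (z * of_real (ln x))"
  by (simp add: powr_def Ln_of_real)

lemma exp_of_real_powr: "exp (complex_of_real u) powr z = exp (z * of_real u)"
  using of_real_powr_eq_exp[of "exp u" z] by (simp add: exp_of_real)

lemma borel_measurable_of_real_powr [measurable (raw)]:
  assumes [measurable]: "f \<in> borel_measurable N" "g \<in> borel_measurable N"
  shows "(\<lambda>x. complex_of_real (f x) powr g x) \<in> borel_measurable N"
proof -
  have "(\<lambda>x. complex_of_real (f x) powr g x) = (\<lambda>x. if f x = 0 then 0
      else exp (g x * (of_real (ln \<bar>f x\<bar>) + (if f x < 0 then \<i> * of_real pi else 0))))"
    by (auto simp: powr_def Ln_of_real' fun_eq_iff mult.commute)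
  then show ?thesis by simp
qed

text \<open>The substitution \<open>t = A * exp u\<close> turns Euler's integral into an integral over the
  whole line, so that later substitutions are translations.\<close>
lemma has_bochner_integral_Gamma_exp:
  fixes z :: complex and A :: real
  assumes z: "Re z > 0" and A: "A > 0"
  shows "has_bochner_integral lborel
    (\<lambda>u. exp (z * of_real u) * of_real (exp (- (A * exp u)))) (Gamma z * of_real A powr (- z))"
proof -
  let ?f = "\<lambda>t::real. of_real t powr (z - 1) / of_real (exp t) :: complex"
  have m: "?f \<in> borel_measurable borel" by measurable
  have si: "set_integrable lborel {0<..} ?f"
    using absolutely_integrable_Gamma_integral'[OF z] m
    by (simp add: set_integrable_def integrable_completion)
  have eq: "exp u *\<^sub>R ?f (exp u) = exp (z * of_real u) * of_real (exp (- exp u))" for u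
  proof -
    have "exp u *\<^sub>R ?f (exp u) = exp (of_real u) * exp ((z - 1) * of_real u) * of_real (exp (- exp u))"
      by (simp add: exp_of_real_powr scaleR_conv_of_real exp_minus field_simps flip: exp_of_real)
    also have "exp (of_real u) * exp ((z - 1) * of_real u) = exp (z * of_real u)"
      by (simp add: algebra_simps flip: exp_add)
    finally show ?thesis .
  qed
  have "integrable lborel (\<lambda>u. exp (z * of_real u) * of_real (exp (- exp u)))"
    using integrable_exp_substitution[OF m] si unfolding eq by simp
  moreover have "(\<integral>u. exp (z * of_real u) * of_real (exp (- exp u)) \<partial>lborel) = Gamma z"
    using integral_exp_substitution[OF m si] Gamma_integral_complex'[OF z] si unfolding eq
    by (simp add: set_borel_integral_eq_integral integral_unique)
  ultimately have "has_bochner_integral lborel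
      (\<lambda>u. exp (z * of_real (ln A + u)) * of_real (exp (- exp (ln A + u)))) (Gamma z)"
    by (intro has_bochner_integral_translate) (simp add: has_bochner_integral_iff)
  then have "has_bochner_integral lborel
      (\<lambda>u. of_real A powr (- z) * (exp (z * of_real (ln A + u)) * of_real (exp (- exp (ln A + u)))))
      (of_real A powr (- z) * Gamma z)"
    by (rule has_bochner_integral_mult_right)
  also have "(\<lambda>u. of_real A powr (- z) * (exp (z * of_real (ln A + u)) * of_real (exp (- exp (ln A + u)))))
     = (\<lambda>u. exp (z * of_real u) * of_real (exp (- (A * exp u))))"
  proof
    fix u
    have "of_real A powr (- z) * exp (z * of_real (ln A + u)) = exp (z * of_real u)"
      using A by (simp add: of_real_powr_eq_exp algebra_simps flip: exp_add)
    then show "of_real A powr (- z) * (exp (z * of_real (ln A + u)) * of_real (exp (- exp (ln A + u))))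
      = exp (z * of_real u) * of_real (exp (- (A * exp u)))"
      using A by (simp add: exp_add mult.assoc [symmetric])
  qed
  finally show ?thesis by (simp add: mult.commute)
qed

lemma has_bochner_integral_Gamma_exp_real:
  fixes a A :: real
  assumes "a > 0" "A > 0"
  shows "has_bochner_integral lborel (\<lambda>u. exp (a * u) * exp (- (A * exp u))) (Gamma a * A powr (- a))"
proof -
  have "has_bochner_integral lborel
    (\<lambda>u. complex_of_real (exp (a * u) * exp (- (A * exp u)))) (of_real (Gamma a * A powr (- a)))"
    using has_bochner_integral_Gamma_exp[of "of_real a" A] assms
    by (simp add: Gamma_complex_of_real powr_of_real[symmetric] exp_of_real[symmetric])
  from has_bochner_integral_bounded_linear[OF bounded_linear_Re this] show ?thesis by simp
qed

text \<open>On the positive half line put \<open>x = exp (u / 2)\<close>; the negative one is its mirror image.\<close>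
lemma has_bochner_integral_square_substitution:
  fixes h :: "real \<Rightarrow> 'a::euclidean_space"
  assumes [measurable]: "h \<in> borel_measurable borel"
    and H: "has_bochner_integral lborel (\<lambda>u. exp (u / 2) *\<^sub>R h (exp u)) I"
  shows "has_bochner_integral lborel (\<lambda>x. h (x\<^sup>2)) I"
proof -
  have "has_bochner_integral lborel (\<lambda>u. exp ((0 + 2 * u) / 2) *\<^sub>R h (exp (0 + 2 * u))) (I /\<^sub>R 2)"
    using H by (subst (asm) lborel_has_bochner_integral_real_affine_iff[of 2 _ _ 0]) auto
  then have H2: "has_bochner_integral lborel (\<lambda>u. exp u *\<^sub>R h ((exp u)\<^sup>2)) (I /\<^sub>R 2)"
    by (simp add: exp_double)
  then have si: "set_integrable lborel {0<..} (\<lambda>x. h (x\<^sup>2))"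
    using integrable_exp_substitution[of "\<lambda>x. h (x\<^sup>2)"] by (auto simp: has_bochner_integral_iff)
  have "(LINT x:{0<..}|lborel. h (x\<^sup>2)) = I /\<^sub>R 2"
    using integral_exp_substitution[OF _ si] H2 by (auto simp: has_bochner_integral_iff)
  then have P: "has_bochner_integral lborel (\<lambda>x. indicator {0<..} x *\<^sub>R h (x\<^sup>2)) (I /\<^sub>R 2)"
    using si by (simp add: set_integrable_def set_lebesgue_integral_def has_bochner_integral_iff)
  then have N: "has_bochner_integral lborel (\<lambda>x. indicator {0<..} (0 + (-1) * x) *\<^sub>R h ((0 + (-1) * x)\<^sup>2)) (I /\<^sub>R 2)"
    by (subst (asm) lborel_has_bochner_integral_real_affine_iff[of "-1" _ _ 0]) auto
  have "has_bochner_integral lborel (\<lambda>x. indicator {0<..} x *\<^sub>R h (x\<^sup>2) +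
      indicator {0<..} (0 + (-1) * x) *\<^sub>R h ((0 + (-1) * x)\<^sup>2)) (I /\<^sub>R 2 + I /\<^sub>R 2)"
    by (intro has_bochner_integral_add P N)
  also have "I /\<^sub>R 2 + I /\<^sub>R 2 = I" by (simp flip: scaleR_left_distrib)
  finally have S: "has_bochner_integral lborel (\<lambda>x. indicator {0<..} x *\<^sub>R h (x\<^sup>2) +
      indicator {0<..} (0 + (-1) * x) *\<^sub>R h ((0 + (-1) * x)\<^sup>2)) I" .
  show ?thesis
    by (rule has_bochner_integralI_AE[OF S])
       (use AE_lborel_singleton[of 0] in \<open>auto elim!: eventually_mono simp: indicator_def\<close>)
qed

text \<open>After x^2 = exp u, the Jacobian exp (u/2) joins the power exp (-s u), and what remains
  is Euler's integral at 1/2 - s. The bound on \<open>Re s\<close> is its convergence as u tends to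
  minus infinity, that is, near x = 0.\<close>

lemma has_bochner_integral_gaussian_moment:
  fixes s :: complex and B :: real
  assumes s: "Re s < 1/2" and B: "B > 0"
  shows "has_bochner_integral lborel
    (\<lambda>x. of_real (x\<^sup>2) powr (- s) * of_real (exp (- (B * x\<^sup>2))))
    (Gamma (1/2 - s) * of_real B powr (s - 1/2))"
proof (rule has_bochner_integral_square_substitution
    [where h = "\<lambda>w. of_real w powr (- s) * of_real (exp (- (B * w)))"])
  show "(\<lambda>w. of_real w powr (- s) * of_real (exp (- (B * w))) :: complex) \<in> borel_measurable borel"
    by measurable
  have "exp (u / 2) *\<^sub>R (of_real (exp u) powr (- s) * of_real (exp (- (B * exp u)))) =
      exp ((1/2 - s) * of_real u) * of_real (exp (- (B * exp u)))" for u
  proof -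
    have "of_real (exp (u / 2)) * complex_of_real (exp u) powr (- s) = exp ((1/2 - s) * of_real u)"
      by (simp add: exp_of_real_powr algebra_simps flip: exp_of_real exp_add)
    then show ?thesis by (simp add: scaleR_conv_of_real mult.assoc [symmetric])
  qed
  then show "has_bochner_integral lborel
     (\<lambda>u. exp (u / 2) *\<^sub>R (of_real (exp u) powr (- s) * of_real (exp (- (B * exp u)))))
     (Gamma (1 / 2 - s) * of_real B powr (s - 1 / 2))"
    using has_bochner_integral_Gamma_exp[of "1/2 - s" B] s B by simp
qed

lemma has_bochner_integral_gaussian_moment_real:
  fixes c B :: real
  assumes "c < 1/2" "B > 0"
  shows "has_bochner_integral lborel (\<lambda>x. (x\<^sup>2) powr (- c) * exp (- (B * x\<^sup>2)))
    (Gamma (1/2 - c) * B powr (c - 1/2))"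
proof -
  have "of_real (x\<^sup>2) powr (- complex_of_real c) = of_real ((x\<^sup>2) powr (- c))" for x :: real
    by (simp add: powr_of_real [symmetric])
  moreover have "Gamma (1/2 - complex_of_real c) = of_real (Gamma (1/2 - c))"
    by (simp add: Gamma_complex_of_real [symmetric])
  moreover have "of_real B powr (complex_of_real c - 1/2) = of_real (B powr (c - 1/2))"
    using assms by (simp add: powr_of_real [symmetric])
  ultimately have "has_bochner_integral lborel
      (\<lambda>x. complex_of_real ((x\<^sup>2) powr (- c) * exp (- (B * x\<^sup>2)))) (of_real (Gamma (1/2 - c) * B powr (c - 1/2)))"
    using has_bochner_integral_gaussian_moment[of "of_real c" B] assms by (simp only: of_real_mult Re_complex_of_real)
  from has_bochner_integral_bounded_linear[OF bounded_linear_Re this] show ?thesis by simp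
qed

section \<open>Fourier inversion and the Cahen-Mellin integral\<close>

text \<open>This is the characteristic function of the standard normal law rescaled by c = sqrt (2
  B), the factor for which (c x)^2 / 2 = B x^2.\<close>

lemma has_bochner_integral_iexp_gaussian:
  fixes B t :: real
  assumes B: "B > 0"
  shows "has_bochner_integral lborel (\<lambda>x. iexp (t * x) * of_real (exp (- (B * x\<^sup>2))))
    (of_real (sqrt (pi / B) * exp (- (t\<^sup>2 / (4 * B)))))"
proof -
  define c where "c = sqrt (2 * B)"
  have c: "c > 0" "c\<^sup>2 = 2 * B" using B by (simp_all add: c_def)
  have std: "has_bochner_integral lborel (\<lambda>x. std_normal_density x *\<^sub>R iexp (r * x))
      (of_real (exp (- (r\<^sup>2 / 2))))" for r
  proof -
    have "integrable lborel (\<lambda>x. std_normal_density x *\<^sub>R iexp (r * x))"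
      using integrable_std_normal_moment_abs[of 0] by (rule Bochner_Integration.integrable_bound) auto
    moreover have "(\<integral>x. std_normal_density x *\<^sub>R iexp (r * x) \<partial>lborel) = char std_normal_distribution r"
      unfolding char_def by (subst integral_density) auto
    ultimately show ?thesis
      by (simp add: has_bochner_integral_iff char_std_normal_distribution)
  qed
  have "has_bochner_integral lborel
      (\<lambda>x. std_normal_density (0 + c * x) *\<^sub>R iexp (t / c * (0 + c * x)))
      (of_real (exp (- ((t / c)\<^sup>2 / 2))) /\<^sub>R \<bar>c\<bar>)"
    using std[of "t / c"] c by (subst (asm) lborel_has_bochner_integral_real_affine_iff[of c _ _ 0]) auto
  from has_bochner_integral_mult_right[OF this, of "of_real (sqrt (2 * pi))"]
  have "has_bochner_integral lborel
      (\<lambda>x. of_real (sqrt (2 * pi)) * (std_normal_density (0 + c * x) *\<^sub>R iexp (t / c * (0 + c * x))))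
      (of_real (sqrt (2 * pi)) * (of_real (exp (- ((t / c)\<^sup>2 / 2))) /\<^sub>R \<bar>c\<bar>))" .
  moreover have "of_real (sqrt (2 * pi)) * (std_normal_density (0 + c * x) *\<^sub>R iexp (t / c * (0 + c * x)))
      = iexp (t * x) * of_real (exp (- (B * x\<^sup>2)))" for x
    using c by (simp add: std_normal_density_def scaleR_conv_of_real power_mult_distrib)
  moreover have "of_real (sqrt (2 * pi)) * (of_real (exp (- ((t / c)\<^sup>2 / 2))) /\<^sub>R \<bar>c\<bar>)
      = complex_of_real (sqrt (pi / B) * exp (- (t\<^sup>2 / (4 * B))))"
  proof -
    have "sqrt (2 * pi) / c = sqrt (pi / B)"
      using B by (simp add: c_def real_sqrt_divide [symmetric])
    moreover have "(t / c)\<^sup>2 / 2 = t\<^sup>2 / (4 * B)" using c by (simp add: power_divide)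
    ultimately show ?thesis using c by (simp add: scaleR_conv_of_real field_simps)
  qed
  ultimately show ?thesis by simp
qed

text \<open>A Gaussian factor \<open>exp (- (e * y)^2 / 2)\<close> makes the double integral absolutely convergent;
  it turns the inner integral into a Gaussian average of \<open>g\<close> around \<open>u\<close>, and \<open>e\<close> tends to 0.\<close>
lemma Fourier_inversion:
  fixes g :: "real \<Rightarrow> complex"
  assumes g: "integrable lborel g"
    and bdd: "\<And>v. norm (g v) \<le> K"
    and cont: "isCont g u"
    and ghat: "integrable lborel (\<lambda>y. \<integral>v. iexp (y * v) * g v \<partial>lborel)"
  shows "(\<integral>y. iexp (- (y * u)) * (\<integral>v. iexp (y * v) * g v \<partial>lborel) \<partial>lborel) = 2 * pi * g u"
proof -
  let ?h = "\<lambda>y. \<integral>v. iexp (y * v) * g v \<partial>lborel"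
  have [measurable]: "g \<in> borel_measurable borel" "?h \<in> borel_measurable borel"
    using g ghat by auto
  define e where "e n = inverse (real (Suc n))" for n
  have e0: "e n > 0" for n by (simp add: e_def)
  have elim: "e \<longlonglongrightarrow> 0" unfolding e_def by (rule LIMSEQ_inverse_real_of_nat)
  define D where "D n y = exp (- ((e n)\<^sup>2 / 2 * y\<^sup>2))" for n and y :: real
  have [measurable]: "D n \<in> borel_measurable borel" for n unfolding D_def by measurable
  have D1: "0 \<le> D n y" "D n y \<le> 1" for n y by (simp_all add: D_def)
  have Dint: "integrable lborel (D n)" for n
    using has_bochner_integral_iexp_gaussian[of "(e n)\<^sup>2 / 2" 0] e0[of n]
    unfolding D_def by (auto simp: has_bochner_integral_iff complex_of_real_integrable_eq simp del: of_real_exp)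
  let ?L = "\<lambda>n. \<integral>y. iexp (- (y * u)) * ?h y * D n y \<partial>lborel"
  have lim1: "?L \<longlonglongrightarrow> (\<integral>y. iexp (- (y * u)) * ?h y \<partial>lborel)"
  proof (rule integral_dominated_convergence[where w = "\<lambda>y. norm (?h y)"])
    show "integrable lborel (\<lambda>y. norm (?h y))" using ghat by simp
    have "(\<lambda>n. iexp (- (y * u)) * ?h y * D n y) \<longlonglongrightarrow> iexp (- (y * u)) * ?h y * of_real (exp (- (0\<^sup>2 / 2 * y\<^sup>2)))" for y
      unfolding D_def by (intro tendsto_intros elim) simp
    then show "AE y in lborel. (\<lambda>n. iexp (- (y * u)) * ?h y * D n y) \<longlonglongrightarrow> iexp (- (y * u)) * ?h y"
      by simp
    show "AE y in lborel. norm (iexp (- (y * u)) * ?h y * D n y) \<le> norm (?h y)" for n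
      using D1 by (auto simp: norm_mult intro!: mult_left_le)
  qed measurable
  have L_eq: "?L n = (\<integral>z. g (u + e n * z) * of_real (sqrt (2 * pi) * exp (- (z\<^sup>2 / 2))) \<partial>lborel)" for n
  proof -
    let ?F = "\<lambda>y v. iexp (- (y * u)) * (iexp (y * v) * g v) * D n y"
    have "integrable (lborel \<Otimes>\<^sub>M lborel) (\<lambda>(y, v). ?F y v)"
    proof (rule lborel_pair.Fubini_integrable)
      show "integrable lborel (\<lambda>y. \<integral>v. norm (case (y, v) of (y, v) \<Rightarrow> ?F y v) \<partial>lborel)"
        using Dint[of n] D1(1)[of n] by (simp add: norm_mult)
      have "integrable lborel (\<lambda>v. iexp (y * v) * g v)" for y
        using g by (rule Bochner_Integration.integrable_bound) (auto simp: norm_mult)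
      then show "AE y in lborel. integrable lborel (\<lambda>v. case (y, v) of (y, v) \<Rightarrow> ?F y v)"
        by auto
    qed measurable
    then have "(\<integral>y. \<integral>v. ?F y v \<partial>lborel \<partial>lborel) = (\<integral>v. \<integral>y. ?F y v \<partial>lborel \<partial>lborel)"
      by (rule lborel_pair.Fubini_integral [symmetric])
    moreover have "?L n = (\<integral>y. \<integral>v. ?F y v \<partial>lborel \<partial>lborel)"
      by simp
    moreover have "(\<integral>y. ?F y v \<partial>lborel) =
        g v * of_real (sqrt (2 * pi) / e n * exp (- ((v - u)\<^sup>2 / (2 * (e n)\<^sup>2))))" for v
    proof -
      have "(\<integral>y. ?F y v \<partial>lborel) =
          (\<integral>y. g v * (iexp ((v - u) * y) * of_real (exp (- ((e n)\<^sup>2 / 2 * y\<^sup>2)))) \<partial>lborel)"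
      proof (rule Bochner_Integration.integral_cong)
        fix y
        have "iexp (- (y * u)) * iexp (y * v) = iexp ((v - u) * y)"
          by (simp add: algebra_simps flip: exp_add)
        then show "?F y v = g v * (iexp ((v - u) * y) * of_real (exp (- ((e n)\<^sup>2 / 2 * y\<^sup>2))))"
          by (simp only: D_def mult.assoc [symmetric]) (simp only: mult_ac)
      qed simp
      moreover have "sqrt (pi / ((e n)\<^sup>2 / 2)) = sqrt (2 * pi) / e n"
        using e0[of n] by (simp add: real_sqrt_divide real_sqrt_mult)
      ultimately show ?thesis
        using has_bochner_integral_iexp_gaussian[of "(e n)\<^sup>2 / 2" "v - u"] e0[of n]
        by (simp add: has_bochner_integral_iff)
    qed
    ultimately have "?L n = (\<integral>v. g v * of_real (sqrt (2 * pi) / e n * exp (- ((v - u)\<^sup>2 / (2 * (e n)\<^sup>2)))) \<partial>lborel)"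
      by simp
    \<comment> \<open>The substitution v = u + e z cancels the factor 1/e and fixes the Gaussian, so
      that \<open>n\<close> survives only in the argument of \<open>g\<close> and dominated
      convergence applies.\<close>
    also have "\<dots> = e n *\<^sub>R (\<integral>z. g (u + e n * z) * of_real (sqrt (2 * pi) / e n *
        exp (- ((u + e n * z - u)\<^sup>2 / (2 * (e n)\<^sup>2)))) \<partial>lborel)"
      using e0[of n] by (subst lborel_integral_real_affine[of "e n" _ u]) auto
    also have "\<dots> = (\<integral>z. g (u + e n * z) * of_real (sqrt (2 * pi) * exp (- (z\<^sup>2 / 2))) \<partial>lborel)"
      unfolding integral_scaleR_right [symmetric]
      using e0[of n] by (intro Bochner_Integration.integral_cong) (auto simp: power_mult_distrib scaleR_conv_of_real field_simps)
    finally show ?thesis .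
  qed
  have gauss: "has_bochner_integral lborel (\<lambda>z. complex_of_real (exp (- (z\<^sup>2 / 2)))) (sqrt (2 * pi))"
    using has_bochner_integral_iexp_gaussian[of "1/2" 0] by (simp add: mult.commute)
  have lim2: "?L \<longlonglongrightarrow> (\<integral>z. g u * of_real (sqrt (2 * pi) * exp (- (z\<^sup>2 / 2))) \<partial>lborel)"
    unfolding L_eq
  proof (rule integral_dominated_convergence[where w = "\<lambda>z. K * (sqrt (2 * pi) * exp (- (z\<^sup>2 / 2)))"])
    show "integrable lborel (\<lambda>z. K * (sqrt (2 * pi) * exp (- (z\<^sup>2 / 2))))"
      using gauss by (auto simp: has_bochner_integral_iff complex_of_real_integrable_eq simp del: of_real_exp)
    have "(\<lambda>n. g (u + e n * z)) \<longlonglongrightarrow> g u" for z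
    proof (rule isCont_tendsto_compose[OF cont])
      have "(\<lambda>n. u + e n * z) \<longlonglongrightarrow> u + 0 * z" by (intro tendsto_intros elim)
      then show "(\<lambda>n. u + e n * z) \<longlonglongrightarrow> u" by simp
    qed
    then show "AE z in lborel. (\<lambda>n. g (u + e n * z) * of_real (sqrt (2 * pi) * exp (- (z\<^sup>2 / 2))))
        \<longlonglongrightarrow> g u * of_real (sqrt (2 * pi) * exp (- (z\<^sup>2 / 2)))"
      by (intro AE_I2 tendsto_mult_right)
    show "AE z in lborel. norm (g (u + e n * z) * of_real (sqrt (2 * pi) * exp (- (z\<^sup>2 / 2))))
        \<le> K * (sqrt (2 * pi) * exp (- (z\<^sup>2 / 2)))" for n
      using bdd by (intro AE_I2) (auto simp: norm_mult simp del: of_real_mult of_real_exp intro!: mult_right_mono)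
  qed measurable
  \<comment> \<open>One factor sqrt (2 pi) comes from the Fourier transform of the regularizing
    Gaussian, the other is the mass of exp (-z^2 / 2).\<close>
  have "(\<integral>z. g u * of_real (sqrt (2 * pi) * exp (- (z\<^sup>2 / 2))) \<partial>lborel) = 2 * pi * g u"
  proof -
    have "(\<integral>z. (g u * sqrt (2 * pi)) * of_real (exp (- (z\<^sup>2 / 2))) \<partial>lborel) = (g u * sqrt (2 * pi)) * sqrt (2 * pi)"
      using gauss by (simp add: has_bochner_integral_iff)
    then show ?thesis by (simp add: mult.assoc flip: of_real_mult)
  qed
  with LIMSEQ_unique[OF lim1 lim2] show ?thesis by simp
qed

section \<open>The Gamma function on vertical lines\<close>

lemma integrable_inverse_1_plus_square_lborel:
  "integrable lborel (\<lambda>y::real. inverse (1 + y\<^sup>2))"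
  using integrable_inverse_1_plus_square by (simp add: set_integrable_def)

text \<open>In Euler's integral the imaginary part of \<open>z\<close> contributes only a phase,
  which the triangle inequality discards.\<close>

lemma norm_Gamma_le:
  assumes "Re z > 0" shows "norm (Gamma z) \<le> Gamma (Re z)"
proof -
  have i: "has_bochner_integral lborel (\<lambda>u. exp (z * of_real u) * of_real (exp (- exp u))) (Gamma z)"
    using has_bochner_integral_Gamma_exp[OF assms, of 1] by simp
  have "norm (Gamma z) \<le> (\<integral>u. norm (exp (z * of_real u) * complex_of_real (exp (- exp u))) \<partial>lborel)"
    using i integral_norm_bound by (metis has_bochner_integral_iff)
  also have "\<dots> = (\<integral>u. exp (Re z * u) * exp (- exp u) \<partial>lborel)"
    by (simp add: norm_mult del: of_real_exp)
  also have "\<dots> = Gamma (Re z)"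
    using has_bochner_integral_Gamma_exp_real[OF assms, of 1] by (simp add: has_bochner_integral_iff)
  finally show ?thesis .
qed

lemma borel_measurable_Gamma_vertical [measurable]:
  assumes "c > 0" shows "(\<lambda>y. Gamma (Complex c y)) \<in> borel_measurable borel"
proof (intro borel_measurable_continuous_onI)
  have "of_real c + \<i> * of_real y \<notin> \<int>\<^sub>\<le>\<^sub>0" for y
    using assms by (auto elim!: nonpos_Ints_cases simp: complex_eq_iff)
  then show "continuous_on UNIV (\<lambda>y. Gamma (Complex c y))"
    unfolding Complex_eq
    by (intro continuous_at_imp_continuous_on ballI isCont_Gamma) (auto intro!: continuous_intros)
qed

text \<open>The functional equation \<open>Gamma (s + 2) = (s + 1) * s * Gamma s\<close> gives quadratic decay.\<close>
lemma integrable_Gamma_vertical: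
  assumes c: "c > 0" shows "integrable lborel (\<lambda>y. Gamma (Complex c y))"
proof (rule Bochner_Integration.integrable_bound)
  \<comment> \<open>Chosen so that d (1 + y^2) is at most c^2 + y^2, the squared modulus of s = c +
    i y.\<close>
  define d where "d = min 1 (c\<^sup>2)"
  have d: "d > 0" using c by (simp add: d_def)
  show "integrable lborel (\<lambda>y. Gamma (c + 2) / d * inverse (1 + y\<^sup>2))"
    by (intro integrable_mult_right integrable_inverse_1_plus_square_lborel)
  show "(\<lambda>y. Gamma (Complex c y)) \<in> borel_measurable lborel" using c by simp
  have "norm (Gamma (Complex c y)) \<le> Gamma (c + 2) / d * inverse (1 + y\<^sup>2)" for y
  proof -
    let ?s = "Complex c y"
    have ns: "?s \<notin> \<int>\<^sub>\<le>\<^sub>0" "?s + 1 \<notin> \<int>\<^sub>\<le>\<^sub>0"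
      using c by (auto elim!: nonpos_Ints_cases simp: complex_eq_iff)
    have "Gamma (?s + 1 + 1) = (?s + 1) * (?s * Gamma ?s)"
      using Gamma_plus1[OF ns(2)] Gamma_plus1[OF ns(1)] by (simp only:)
    then have "norm (?s + 1) * (norm ?s * norm (Gamma ?s)) = norm (Gamma (?s + 2))"
      by (simp add: norm_mult [symmetric] add.assoc)
    also have "\<dots> \<le> Gamma (c + 2)" using norm_Gamma_le[of "?s + 2"] c by simp
    finally have 1: "norm (?s + 1) * (norm ?s * norm (Gamma ?s)) \<le> Gamma (c + 2)" .
    have le: "norm ?s \<le> norm (?s + 1)"
      unfolding cmod_def using c by (intro real_sqrt_le_mono) (simp add: power2_eq_square algebra_simps)
    have "d * (1 + y\<^sup>2) \<le> c\<^sup>2 + y\<^sup>2"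
      by (simp add: d_def distrib_left add_mono mult_left_le_one_le)
    also have "\<dots> = norm ?s * norm ?s" by (simp add: cmod_def)
    also have "\<dots> \<le> norm (?s + 1) * norm ?s" using le by (intro mult_right_mono) auto
    finally have "d * (1 + y\<^sup>2) * norm (Gamma ?s) \<le> norm (?s + 1) * norm ?s * norm (Gamma ?s)"
      by (intro mult_right_mono) auto
    with 1 have "d * (1 + y\<^sup>2) * norm (Gamma ?s) \<le> Gamma (c + 2)" by (simp add: mult.assoc)
    then show ?thesis using d
      by (simp add: field_simps add_pos_nonneg)
  qed
  then show "AE y in lborel. norm (Gamma (Complex c y)) \<le> norm (Gamma (c + 2) / d * inverse (1 + y\<^sup>2))"
    unfolding real_norm_def by (intro AE_I2 order_trans[OF _ abs_ge_self])
qed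

text \<open>Fourier inversion of \<open>exp (c * u) * exp (- exp u)\<close>, whose transform is \<open>Gamma\<close> on the line
  \<open>Re s = c\<close>.\<close>
lemma Cahen_Mellin:
  assumes c: "c > 0" and w: "w > 0"
  shows "(\<integral>y. Gamma (Complex c y) * of_real w powr (- Complex c y) \<partial>lborel) = 2 * pi * exp (- w)"
proof -
  define g where "g v = complex_of_real (exp (c * v) * exp (- exp v))" for v
  have eq: "iexp (y * v) * g v = exp (Complex c y * of_real v) * of_real (exp (- exp v))" for y v
    by (simp add: g_def Complex_eq algebra_simps exp_add flip: exp_of_real)
  have ghat: "(\<integral>v. iexp (y * v) * g v \<partial>lborel) = Gamma (Complex c y)" for y
    using has_bochner_integral_Gamma_exp[of "Complex c y" 1] c unfolding eq
    by (simp add: has_bochner_integral_iff)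
  have gi: "integrable lborel g"
    using has_bochner_integral_Gamma_exp_real[of c 1] c unfolding g_def complex_of_real_integrable_eq
    by (simp add: has_bochner_integral_iff)
  have "(\<integral>y. iexp (- (y * ln w)) * (\<integral>v. iexp (y * v) * g v \<partial>lborel) \<partial>lborel) = 2 * pi * g (ln w)"
  proof (rule Fourier_inversion[OF gi])
    show "isCont g (ln w)" unfolding g_def by (intro continuous_intros)
    show "integrable lborel (\<lambda>y. \<integral>v. iexp (y * v) * g v \<partial>lborel)"
      unfolding ghat by (rule integrable_Gamma_vertical[OF c])
    \<comment> \<open>The exponent c v - exp v attains its maximum at v = ln c. The proof uses exp a
      \<ge> 1 + a at a = v - ln c.\<close>
    show "norm (g v) \<le> exp (c * ln c - c)" for v
    proof -
      have "v - ln c \<le> exp v / c - 1"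
        using exp_ge_add_one_self[of "v - ln c"] c by (simp add: exp_diff)
      then have "c * (v - ln c) \<le> c * (exp v / c - 1)" using c by (intro mult_left_mono) auto
      then have "c * v - exp v \<le> c * ln c - c" using c by (simp add: algebra_simps)
      moreover have "norm (g v) = exp (c * v - exp v)"
        by (simp add: g_def norm_mult diff_conv_add_uminus exp_add del: of_real_exp add_uminus_conv_diff)
      ultimately show ?thesis by simp
    qed
  qed
  then have inv: "(\<integral>y. iexp (- (y * ln w)) * Gamma (Complex c y) \<partial>lborel) = 2 * pi * g (ln w)"
    unfolding ghat .
  \<comment> \<open>The power splits into a modulus and a phase. The modulus exp (-c ln w) cancels
    the weight exp (c v) of \<open>g\<close> at v = ln w.\<close>
  have "of_real w powr (- Complex c y) = of_real (exp (- (c * ln w))) * iexp (- (y * ln w))" for y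
    using w by (simp add: of_real_powr_eq_exp Complex_eq algebra_simps flip: exp_of_real exp_add)
  then have "(\<integral>y. Gamma (Complex c y) * of_real w powr (- Complex c y) \<partial>lborel) =
      (\<integral>y. of_real (exp (- (c * ln w))) * (iexp (- (y * ln w)) * Gamma (Complex c y)) \<partial>lborel)"
    by (simp add: mult_ac)
  also have "\<dots> = of_real (exp (- (c * ln w))) * (2 * pi * g (ln w))"
    by (simp only: integral_mult_right_zero inv)
  also have "\<dots> = complex_of_real (2 * pi * (exp (- (c * ln w)) * (exp (c * ln w) * exp (- w))))"
    using w by (simp only: g_def exp_ln of_real_mult mult_ac)
  also have "exp (- (c * ln w)) * (exp (c * ln w) * exp (- w)) = exp (- w)"
    by (simp add: mult.assoc [symmetric] flip: exp_add)
  finally show ?thesis by simp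
qed

section \<open>The variance-gamma density as a Gaussian mixture\<close>

text \<open>The integrand of \<open>besselK\<close> after the translation \<open>t = u - ln \<bar>x\<bar>\<close>, which makes it Gaussian in
  \<open>x\<close> with variance \<open>exp u / \<alpha>\<close>.\<close>
definition vg_kernel :: "real \<Rightarrow> real \<Rightarrow> real \<Rightarrow> real \<Rightarrow> real" where
  "vg_kernel \<mu> \<alpha> u x = exp (\<mu> * u) * exp (- (\<alpha>/2 * exp u)) * exp (- (\<alpha>/2 * exp (- u) * x\<^sup>2))"

lemma borel_measurable_vg_kernel [measurable (raw)]:
  assumes [measurable]: "f \<in> borel_measurable N" "g \<in> borel_measurable N"
  shows "(\<lambda>x. vg_kernel \<mu> \<alpha> (f x) (g x)) \<in> borel_measurable N"
  unfolding vg_kernel_def by measurable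

lemma vg_kernel_nonneg: "vg_kernel \<mu> \<alpha> u x \<ge> 0"
  by (simp add: vg_kernel_def)

text \<open>For \<mu> \<le> 0 the factor exp (\<mu> u) is not integrable at minus infinity, and the
  Gaussian factor must help. The bound exp (-z) \<le> 1/z trades it for one extra exp u, leaving
  Euler's integral at \<mu> + 1.\<close>

lemma integrable_vg_kernel:
  assumes "\<mu> > -1" "\<alpha> > 0" "x \<noteq> 0"
  shows "integrable lborel (\<lambda>u. vg_kernel \<mu> \<alpha> u x)"
proof (rule Bochner_Integration.integrable_bound)
  show "integrable lborel (\<lambda>u. 2 / (\<alpha> * x\<^sup>2) * (exp ((\<mu> + 1) * u) * exp (- (\<alpha>/2 * exp u))))"
    using has_bochner_integral_Gamma_exp_real[of "\<mu> + 1" "\<alpha>/2"] assms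
    by (simp add: has_bochner_integral_iff)
  have "vg_kernel \<mu> \<alpha> u x \<le> 2 / (\<alpha> * x\<^sup>2) * (exp ((\<mu> + 1) * u) * exp (- (\<alpha>/2 * exp u)))" for u
  proof -
    define z where "z = \<alpha>/2 * exp (- u) * x\<^sup>2"
    have z: "z > 0" using assms by (simp add: z_def)
    then have "exp (- z) \<le> 1 / z"
      using exp_ge_add_one_self[of z] by (simp add: exp_minus field_simps del: exp_ge_add_one_self)
    also have "1 / z = 2 / (\<alpha> * x\<^sup>2) * exp u"
      using assms by (simp add: z_def exp_minus field_simps)
    finally have "exp (\<mu> * u) * exp (- (\<alpha>/2 * exp u)) * exp (- z)
        \<le> exp (\<mu> * u) * exp (- (\<alpha>/2 * exp u)) * (2 / (\<alpha> * x\<^sup>2) * exp u)"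
      by (intro mult_left_mono) auto
    also have "\<dots> = 2 / (\<alpha> * x\<^sup>2) * (exp ((\<mu> + 1) * u) * exp (- (\<alpha>/2 * exp u)))"
      by (simp add: exp_add ring_distribs)
    finally show ?thesis by (simp add: vg_kernel_def z_def)
  qed
  then show "AE u in lborel. norm (vg_kernel \<mu> \<alpha> u x)
      \<le> norm (2 / (\<alpha> * x\<^sup>2) * (exp ((\<mu> + 1) * u) * exp (- (\<alpha>/2 * exp u))))"
    using vg_kernel_nonneg assms by (intro AE_I2) (simp add: abs_of_nonneg)
qed measurable

text \<open>cosh (\<nu> t) averages exp (\<nu> t) and exp (-\<nu> t), and cosh t is even. Reflecting
  the second half therefore unfolds the half line to the whole line, at the price of a factor
  1/2.\<close>

lemma besselK_eq_whole_line:
  assumes h: "integrable lborel (\<lambda>t. exp (- (x * cosh t)) * exp (\<nu> * t))"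
  shows "besselK \<nu> x = (\<integral>t. exp (- (x * cosh t)) * exp (\<nu> * t) \<partial>lborel) / 2"
proof -
  define h where "h t = exp (- (x * cosh t)) * exp (\<nu> * t)" for t
  \<comment> \<open>Both pieces keep the point 0, so that \<open>eq\<close> holds at every t. In
    return p + q = h holds only almost everywhere.\<close>
  define p where "p t = indicator {0..} t *\<^sub>R h t" for t :: real
  define q where "q t = indicator {..0} t *\<^sub>R h t" for t :: real
  have [measurable]: "h \<in> borel_measurable borel"
    using h unfolding h_def [symmetric, abs_def] by (simp add: borel_measurable_integrable)
  have hi: "integrable lborel h" using h by (simp add: h_def [abs_def])
  have p: "integrable lborel p" and q: "integrable lborel q"
    unfolding p_def [abs_def] q_def [abs_def] by (intro integrable_mult_indicator hi; simp)+
  have qr: "has_bochner_integral lborel (\<lambda>t. q (0 + (-1) * t)) (integral\<^sup>L lborel q)"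
    using lborel_has_bochner_integral_real_affine_iff[of "-1" q "integral\<^sup>L lborel q" 0] q
    by (simp add: has_bochner_integral_iff)
  have eq: "indicator {0..} t *\<^sub>R (exp (- x * cosh t) * cosh (\<nu> * t)) = (p t + q (0 + (-1) * t)) / 2" for t
    by (simp add: p_def q_def h_def cosh_def indicator_def algebra_simps)
  have pq: "has_bochner_integral lborel (\<lambda>t. (p t + q (0 + (-1) * t)) / 2)
      ((integral\<^sup>L lborel p + integral\<^sup>L lborel q) / 2)"
    by (intro has_bochner_integral_divide_zero has_bochner_integral_add qr)
       (use p in \<open>simp add: has_bochner_integral_iff\<close>)
  then have si: "set_integrable lborel {0..} (\<lambda>t. exp (- x * cosh t) * cosh (\<nu> * t))"
    unfolding set_integrable_def eq by (simp add: has_bochner_integral_iff)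
  have "besselK \<nu> x = (LINT t:{0..}|lborel. exp (- x * cosh t) * cosh (\<nu> * t))"
    unfolding besselK_def by (rule set_borel_integral_eq_integral(2)[OF si, symmetric])
  also have "\<dots> = (integral\<^sup>L lborel p + integral\<^sup>L lborel q) / 2"
    unfolding set_lebesgue_integral_def eq using pq by (simp add: has_bochner_integral_iff)
  also have "integral\<^sup>L lborel p + integral\<^sup>L lborel q = (\<integral>t. p t + q t \<partial>lborel)"
    using p q by simp
  also have "\<dots> = integral\<^sup>L lborel h"
  proof (rule integral_cong_AE)
    show "AE t in lborel. p t + q t = h t"
      using AE_lborel_singleton[of 0] by (auto elim!: eventually_mono simp: p_def q_def indicator_def)
  qed (simp_all add: p_def [abs_def] q_def [abs_def])
  finally show ?thesis by (simp add: h_def [abs_def])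
qed

text \<open>Shifting u by ln \<bar>x\<bar> balances the exponentials exp u and x^2 exp (-u) into 2
  \<bar>x\<bar> cosh t. The point x = 0 is a true exception: for \<mu> > 0 the density there is 0,
  since \<open>0 powr \<mu>\<close> is 0, while the integral is positive. Later uses are therefore
  almost everywhere.\<close>

lemma vg_pdf_eq_integral:
  assumes \<mu>: "\<mu> > -1/2" and \<alpha>: "\<alpha> > 0" and x: "x \<noteq> 0"
  shows "vg_pdf \<mu> \<alpha> 0 x =
    (\<alpha>/2) powr (\<mu> + 1) / (sqrt pi * Gamma (\<mu> + 1/2)) * (\<integral>u. vg_kernel \<mu> \<alpha> u x \<partial>lborel)"
proof -
  define r where "r = \<bar>x\<bar>"
  have r: "r > 0" "x\<^sup>2 = r * r" using x by (simp_all add: r_def power2_eq_square)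
  have i: "integrable lborel (\<lambda>u. vg_kernel \<mu> \<alpha> u x)"
    using \<mu> \<alpha> x by (intro integrable_vg_kernel) auto
  have eq: "vg_kernel \<mu> \<alpha> (ln r + t) x = r powr \<mu> * (exp (- (\<alpha> * r * cosh t)) * exp (\<mu> * t))" for t
  proof -
    have "\<alpha>/2 * exp (ln r + t) + \<alpha>/2 * exp (- (ln r + t)) * x\<^sup>2 = \<alpha> * r * cosh t"
      using r by (simp add: exp_add exp_diff exp_minus cosh_def field_simps)
    then have "exp (- (\<alpha>/2 * exp (ln r + t))) * exp (- (\<alpha>/2 * exp (- (ln r + t)) * x\<^sup>2))
        = exp (- (\<alpha> * r * cosh t))"
      by (metis exp_add minus_add_distrib)
    moreover have "exp (\<mu> * (ln r + t)) = r powr \<mu> * exp (\<mu> * t)"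
      using r by (simp add: powr_def distrib_left exp_add)
    ultimately show ?thesis by (simp add: vg_kernel_def mult.assoc)
  qed
  have "has_bochner_integral lborel (\<lambda>t. r powr \<mu> * (exp (- (\<alpha> * r * cosh t)) * exp (\<mu> * t)))
      (\<integral>u. vg_kernel \<mu> \<alpha> u x \<partial>lborel)"
    using has_bochner_integral_translate[OF has_bochner_integral_integrable[OF i], of "ln r"]
    unfolding eq .
  moreover from this have "integrable lborel (\<lambda>t. exp (- (\<alpha> * r * cosh t)) * exp (\<mu> * t))"
    using r by (simp add: has_bochner_integral_iff)
  ultimately have K: "r powr \<mu> * besselK \<mu> (\<alpha> * r) = (\<integral>u. vg_kernel \<mu> \<alpha> u x \<partial>lborel) / 2"
    by (simp add: besselK_eq_whole_line has_bochner_integral_iff)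
  have "vg_pdf \<mu> \<alpha> 0 x =
      (\<alpha>\<^sup>2) powr (\<mu> + 1/2) / (2 * \<alpha>) powr \<mu> / (sqrt pi * Gamma (\<mu> + 1/2)) * (r powr \<mu> * besselK \<mu> (\<alpha> * r))"
    by (simp add: vg_pdf_def r_def mult_ac)
  \<comment> \<open>The factor 2 produced here cancels the 1/2 in \<open>K\<close>.\<close>
  also have "(\<alpha>\<^sup>2) powr (\<mu> + 1/2) / (2 * \<alpha>) powr \<mu> = 2 * (\<alpha>/2) powr (\<mu> + 1)"
  proof -
    have "\<alpha>\<^sup>2 = \<alpha> powr 2" using \<alpha> by (simp add: powr_numeral)
    then have "(\<alpha>\<^sup>2) powr (\<mu> + 1/2) = \<alpha> powr (\<mu> + (\<mu> + 1))"
      by (simp add: powr_powr algebra_simps)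
    also have "\<dots> = \<alpha> powr \<mu> * (\<alpha> powr \<mu> * \<alpha>)"
      using \<alpha> by (simp only: powr_add powr_one)
    finally show ?thesis using \<alpha> by (simp add: powr_add powr_mult powr_divide)
  qed
  finally show ?thesis unfolding K by simp
qed

section \<open>Integration against the variance-gamma density\<close>

lemma borel_measurable_vg_pdf:
  assumes "\<mu> > -1/2" "\<alpha> > 0"
  shows "vg_pdf \<mu> \<alpha> 0 \<in> borel_measurable borel"
proof -
  \<comment> \<open>A parameter integral over \<open>lborel\<close> of a jointly measurable kernel
    is measurable, which is not visible from the gauge integral defining
    \<open>besselK\<close>.\<close>
  have "vg_pdf \<mu> \<alpha> 0 = (\<lambda>x. if x = 0 then vg_pdf \<mu> \<alpha> 0 0 else
      (\<alpha>/2) powr (\<mu> + 1) / (sqrt pi * Gamma (\<mu> + 1/2)) * (\<integral>u. vg_kernel \<mu> \<alpha> u x \<partial>lborel))"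
    using vg_pdf_eq_integral[OF assms] by auto
  also have "\<dots> \<in> borel_measurable borel" by measurable
  finally show ?thesis .
qed

lemma vg_pdf_nonneg:
  assumes "\<mu> > -1/2" "\<alpha> > 0" "x \<noteq> 0"
  shows "vg_pdf \<mu> \<alpha> 0 x \<ge> 0"
  using assms
  by (simp add: vg_pdf_eq_integral vg_kernel_nonneg integral_nonneg Gamma_real_nonneg)

text \<open>Fubini for the mixture: integrate \<open>h\<close> against the Gaussian of variance exp
  u / \<alpha> first, then over u. \<open>N\<close> is the absolute inner integral, so
  \<open>outer\<close> is the condition that makes the double integral absolutely
  convergent.\<close>

lemma has_bochner_integral_vg_pdf:
  fixes h :: "real \<Rightarrow> complex"
  assumes \<mu>: "\<mu> > -1/2" and \<alpha>: "\<alpha> > 0"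
    and [measurable]: "h \<in> borel_measurable borel"
    and inner: "\<And>u. has_bochner_integral lborel (\<lambda>x. h x * exp (- (\<alpha>/2 * exp (- u) * x\<^sup>2))) (H u)"
    and inner_norm: "\<And>u. (\<integral>x. norm (h x) * exp (- (\<alpha>/2 * exp (- u) * x\<^sup>2)) \<partial>lborel) = N u"
    and outer: "integrable lborel (\<lambda>u. exp (\<mu> * u) * exp (- (\<alpha>/2 * exp u)) * N u)"
  shows "has_bochner_integral lborel (\<lambda>x. vg_pdf \<mu> \<alpha> 0 x *\<^sub>R h x)
    (((\<alpha>/2) powr (\<mu> + 1) / (sqrt pi * Gamma (\<mu> + 1/2))) *\<^sub>R
       (\<integral>u. of_real (exp (\<mu> * u) * exp (- (\<alpha>/2 * exp u))) * H u \<partial>lborel))"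
proof -
  note [measurable] = borel_measurable_vg_pdf[OF \<mu> \<alpha>]
  let ?K = "(\<alpha>/2) powr (\<mu> + 1) / (sqrt pi * Gamma (\<mu> + 1/2))"
  let ?F = "\<lambda>u x. vg_kernel \<mu> \<alpha> u x *\<^sub>R h x"
  have F_eq: "?F u x = of_real (exp (\<mu> * u) * exp (- (\<alpha>/2 * exp u))) *
      (h x * of_real (exp (- (\<alpha>/2 * exp (- u) * x\<^sup>2))))" for u x
    by (simp add: vg_kernel_def scaleR_conv_of_real mult_ac del: of_real_exp)
  have norm_F: "norm (?F u x) = exp (\<mu> * u) * exp (- (\<alpha>/2 * exp u)) *
      (norm (h x) * exp (- (\<alpha>/2 * exp (- u) * x\<^sup>2)))" for u x
    by (simp add: vg_kernel_def mult_ac)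
  have int: "integrable (lborel \<Otimes>\<^sub>M lborel) (\<lambda>(u, x). ?F u x)"
  proof (rule lborel_pair.Fubini_integrable)
    show "integrable lborel (\<lambda>u. \<integral>x. norm (case (u, x) of (u, x) \<Rightarrow> ?F u x) \<partial>lborel)"
      using outer unfolding prod.case norm_F integral_mult_right_zero inner_norm .
    show "AE u in lborel. integrable lborel (\<lambda>x. case (u, x) of (u, x) \<Rightarrow> ?F u x)"
      using inner unfolding prod.case F_eq by (auto simp: has_bochner_integral_iff)
  qed measurable
  have inner_F: "(\<integral>x. ?F u x \<partial>lborel) = of_real (exp (\<mu> * u) * exp (- (\<alpha>/2 * exp u))) * H u" for u
    using inner[of u] unfolding F_eq integral_mult_right_zero by (simp add: has_bochner_integral_iff)
  have "integrable lborel (\<lambda>x. \<integral>u. ?F u x \<partial>lborel)"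
    using lborel_pair.integrable_snd[of "\<lambda>u x. ?F u x"] int by simp
  moreover have "(\<integral>x. \<integral>u. ?F u x \<partial>lborel \<partial>lborel) =
      (\<integral>u. of_real (exp (\<mu> * u) * exp (- (\<alpha>/2 * exp u))) * H u \<partial>lborel)"
    using lborel_pair.Fubini_integral[OF int] unfolding inner_F .
  ultimately have "has_bochner_integral lborel (\<lambda>x. ?K *\<^sub>R (\<integral>u. ?F u x \<partial>lborel))
      (?K *\<^sub>R (\<integral>u. of_real (exp (\<mu> * u) * exp (- (\<alpha>/2 * exp u))) * H u \<partial>lborel))"
    by (intro has_bochner_integral_scaleR_right) (simp add: has_bochner_integral_iff)
  moreover have ae: "AE x in lborel. ?K *\<^sub>R (\<integral>u. ?F u x \<partial>lborel) = vg_pdf \<mu> \<alpha> 0 x *\<^sub>R h x"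
    using AE_lborel_singleton[of 0]
  proof eventually_elim
    case (elim x)
    then show ?case
      using vg_pdf_eq_integral[OF \<mu> \<alpha>, of x] integrable_vg_kernel[of \<mu> \<alpha> x] \<mu> \<alpha> by simp
  qed
  ultimately show ?thesis
    by (intro has_bochner_integralI_AE[OF _ _ ae]) (use \<mu> \<alpha> in measurable)
qed

text \<open>The Gaussian integral turns the frequency into a factor exponential in the variance, so
  the outer integral is the Laplace transform of a gamma law, again Euler's integral.\<close>

lemma has_bochner_integral_vg_pdf_iexp:
  assumes n: "n > -1/2" and \<alpha>: "\<alpha> > 0"
  shows "has_bochner_integral lborel (\<lambda>y. vg_pdf n \<alpha> 0 y *\<^sub>R iexp (s * y))
    (of_real ((1 + s\<^sup>2 / \<alpha>\<^sup>2) powr (- (n + 1/2))))"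
proof -
  define B where "B v = \<alpha>/2 * exp (- v)" for v
  \<comment> \<open>The inner Gaussian integral at frequency r. Since \<open>iexp\<close> has
    modulus 1, \<open>N 0\<close> is also the absolute inner integral.\<close>
  define N where "N r v = sqrt (2 * pi / \<alpha>) * exp (v / 2) * exp (- (r\<^sup>2 / (2 * \<alpha>) * exp v))" for r v
  \<comment> \<open>The total rate of exp v: \<alpha>/2 from the mixing weight plus the contribution
    of the frequency in \<open>N r\<close>.\<close>
  define A where "A r = \<alpha>/2 + r\<^sup>2 / (2 * \<alpha>)" for r
  have B: "B v > 0" for v using \<alpha> by (simp add: B_def)
  have A: "A r > 0" for r using \<alpha> by (simp add: A_def add_pos_nonneg)
  have N_eq: "sqrt (pi / B v) * exp (- (r\<^sup>2 / (4 * B v))) = N r v" for r v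
  proof -
    have "pi / B v = 2 * pi / \<alpha> * (exp (v / 2))\<^sup>2"
      using \<alpha> by (simp add: B_def exp_minus field_simps flip: exp_double)
    then have "sqrt (pi / B v) = sqrt (2 * pi / \<alpha>) * exp (v / 2)"
      by (simp only: real_sqrt_mult real_sqrt_abs abs_exp_cancel)
    moreover have "r\<^sup>2 / (4 * B v) = r\<^sup>2 / (2 * \<alpha>) * exp v"
      using \<alpha> by (simp add: B_def exp_minus field_simps)
    ultimately show ?thesis by (simp add: N_def)
  qed
  have gauss: "has_bochner_integral lborel (\<lambda>x. iexp (r * x) * of_real (exp (- (B v * x\<^sup>2)))) (of_real (N r v))" for r v
    using has_bochner_integral_iexp_gaussian[OF B] N_eq by metis
  have outer: "has_bochner_integral lborel (\<lambda>v. exp (n * v) * exp (- (\<alpha>/2 * exp v)) * N r v)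
      (sqrt (2 * pi / \<alpha>) * (Gamma (n + 1/2) * A r powr (- (n + 1/2))))" for r
  proof -
    have "exp (n * v) * exp (- (\<alpha>/2 * exp v)) * N r v =
        sqrt (2 * pi / \<alpha>) * (exp ((n + 1/2) * v) * exp (- (A r * exp v)))" for v
    proof -
      have "exp ((n + 1/2) * v) = exp (n * v) * exp (v / 2)"
        by (simp add: ring_distribs flip: exp_add)
      moreover have "exp (- (A r * exp v)) = exp (- (\<alpha>/2 * exp v)) * exp (- (r\<^sup>2 / (2 * \<alpha>) * exp v))"
        by (simp add: A_def ring_distribs flip: exp_add)
      ultimately show ?thesis by (simp add: N_def)
    qed
    then show ?thesis
      using has_bochner_integral_Gamma_exp_real[of "n + 1/2" "A r"] A[of r] n
      by (auto intro!: has_bochner_integral_mult_right)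
  qed
  have "has_bochner_integral lborel (\<lambda>x. vg_pdf n \<alpha> 0 x *\<^sub>R iexp (s * x))
    (((\<alpha>/2) powr (n + 1) / (sqrt pi * Gamma (n + 1/2))) *\<^sub>R
       (\<integral>u. of_real (exp (n * u) * exp (- (\<alpha>/2 * exp u))) * of_real (N s u) \<partial>lborel))"
  proof (rule has_bochner_integral_vg_pdf[OF n \<alpha>, where N = "N 0"])
    show "has_bochner_integral lborel (\<lambda>x. iexp (s * x) * of_real (exp (- (\<alpha>/2 * exp (- u) * x\<^sup>2)))) (of_real (N s u))" for u
      using gauss unfolding B_def .
    have "has_bochner_integral lborel (\<lambda>x. complex_of_real (exp (- (B u * x\<^sup>2)))) (of_real (N 0 u))" for u
      using gauss[of 0 u] by simp
    from has_bochner_integral_bounded_linear[OF bounded_linear_Re this]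
    show "(\<integral>x. norm (iexp (s * x)) * exp (- (\<alpha>/2 * exp (- u) * x\<^sup>2)) \<partial>lborel) = N 0 u" for u
      by (simp add: B_def has_bochner_integral_iff)
    show "integrable lborel (\<lambda>u. exp (n * u) * exp (- (\<alpha>/2 * exp u)) * N 0 u)"
      using outer[of 0] by (simp add: has_bochner_integral_iff)
  qed measurable
  also have "(\<integral>u. of_real (exp (n * u) * exp (- (\<alpha>/2 * exp u))) * of_real (N s u) \<partial>lborel) =
      complex_of_real (sqrt (2 * pi / \<alpha>) * (Gamma (n + 1/2) * A s powr (- (n + 1/2))))"
    unfolding of_real_mult [symmetric] integral_complex_of_real
    using outer[of s] by (simp add: has_bochner_integral_iff mult.assoc)
  also have "((\<alpha>/2) powr (n + 1) / (sqrt pi * Gamma (n + 1/2))) *\<^sub>R \<dots> =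
      of_real ((1 + s\<^sup>2 / \<alpha>\<^sup>2) powr (- (n + 1/2)))"
  proof -
    have g: "Gamma (n + 1/2) > 0" using n by simp
    have "sqrt (2 * pi / \<alpha>) = sqrt pi * (\<alpha>/2) powr (-(1/2))"
      using \<alpha> by (simp add: powr_minus powr_half_sqrt real_sqrt_divide real_sqrt_mult field_simps)
    then have "(\<alpha>/2) powr (n + 1) / (sqrt pi * Gamma (n + 1/2)) *
        (sqrt (2 * pi / \<alpha>) * (Gamma (n + 1/2) * A s powr (- (n + 1/2)))) =
        (\<alpha>/2) powr (n + 1) * (\<alpha>/2) powr (-(1/2)) * A s powr (- (n + 1/2))"
      using g by simp
    also have "(\<alpha>/2) powr (n + 1) * (\<alpha>/2) powr (-(1/2)) = (\<alpha>/2) powr (n + 1/2)"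
      by (simp add: add.commute flip: powr_add)
    also have "(\<alpha>/2) powr (n + 1/2) * A s powr (- (n + 1/2)) = (1 + s\<^sup>2 / \<alpha>\<^sup>2) powr (- (n + 1/2))"
    proof -
      have "A s = \<alpha>/2 * (1 + s\<^sup>2 / \<alpha>\<^sup>2)" using \<alpha> by (simp add: A_def field_simps power2_eq_square)
      then have "A s powr (- (n + 1/2)) = (\<alpha>/2) powr (- (n + 1/2)) * (1 + s\<^sup>2 / \<alpha>\<^sup>2) powr (- (n + 1/2))"
        by (simp only:) (subst powr_mult; use \<alpha> in simp)
      moreover have "(\<alpha>/2) powr (n + 1/2) * (\<alpha>/2) powr (- (n + 1/2)) = 1"
        using \<alpha> by (simp only: powr_minus) simp
      ultimately show ?thesis by (metis mult.assoc mult_1)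
    qed
    finally show ?thesis by (simp only: scaleR_conv_of_real of_real_mult [symmetric])
  qed
  finally show ?thesis .
qed

text \<open>Two Euler integrals in succession. The Gaussian moment gives Gamma (1/2 - s) times a
  power of the variance, and that power moves the exponent of the mixing weight from m to m + 1/2 -
  s. The two bounds on \<open>Re s\<close> are their conditions of convergence.\<close>

lemma has_bochner_integral_vg_pdf_moment:
  fixes s :: complex
  assumes m: "m > -1/2" and \<alpha>: "\<alpha> > 0" and s: "Re s < 1/2" "Re s < m + 1/2"
  shows "has_bochner_integral lborel (\<lambda>x. vg_pdf m \<alpha> 0 x *\<^sub>R of_real (x\<^sup>2) powr (- s))
    (of_real (\<alpha>\<^sup>2 / 4) powr s * Gamma (1/2 - s) * Gamma (of_real (m + 1/2) - s)
      / of_real (sqrt pi * Gamma (m + 1/2)))"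
proof -
  define c where "c = Re s"
  \<comment> \<open>All powers of \<alpha>/2 become exponentials of multiples of \<open>L\<close>.
    Their exponents m + 1, s - 1/2 and -(m + 1/2 - s) add up to 2 s, which gives the power s of
    \<alpha>^2 / 4.\<close>
  define L where "L = ln (\<alpha>/2)"
  define B where "B v = \<alpha>/2 * exp (- v)" for v
  have B: "B v > 0" for v using \<alpha> by (simp add: B_def)
  have a2: "exp L = \<alpha>/2" using \<alpha> by (simp add: L_def)
  have lnB: "ln (B v) = L - v" for v using \<alpha> unfolding B_def L_def by (subst ln_mult) auto
  \<comment> \<open>The same rearrangement is made twice: with c = Re s for the absolute integral,
    and in \<open>cplx\<close> with s itself for the value.\<close>
  have real: "exp (m * u) * exp (- (\<alpha>/2 * exp u)) * (Gamma (1/2 - c) * B u powr (c - 1/2)) =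
     Gamma (1/2 - c) * exp ((c - 1/2) * L) * (exp ((m + 1/2 - c) * u) * exp (- (\<alpha>/2 * exp u)))" for u
  proof -
    have "exp (m * u) * B u powr (c - 1/2) = exp ((c - 1/2) * L) * exp ((m + 1/2 - c) * u)"
      using B[of u] by (simp add: powr_def lnB algebra_simps diff_divide_distrib flip: exp_add)
    then show ?thesis by (simp add: mult_ac)
  qed
  have cplx: "of_real (exp (m * u) * exp (- (\<alpha>/2 * exp u))) * (Gamma (1/2 - s) * of_real (B u) powr (s - 1/2)) =
     Gamma (1/2 - s) * exp ((s - 1/2) * L) *
     (exp ((of_real (m + 1/2) - s) * of_real u) * of_real (exp (- (\<alpha>/2 * exp u))))" for u
  proof -
    have "of_real (exp (m * u)) * of_real (B u) powr (s - 1/2) =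
        exp ((s - 1/2) * L) * exp ((of_real (m + 1/2) - s) * of_real u)"
      using B[of u] by (simp add: of_real_powr_eq_exp lnB algebra_simps diff_divide_distrib flip: exp_add exp_of_real)
    then show ?thesis by (simp add: mult_ac)
  qed
  have "has_bochner_integral lborel (\<lambda>x. vg_pdf m \<alpha> 0 x *\<^sub>R of_real (x\<^sup>2) powr (- s))
    (((\<alpha>/2) powr (m + 1) / (sqrt pi * Gamma (m + 1/2))) *\<^sub>R
       (\<integral>u. of_real (exp (m * u) * exp (- (\<alpha>/2 * exp u))) * (Gamma (1/2 - s) * of_real (B u) powr (s - 1/2)) \<partial>lborel))"
  proof (rule has_bochner_integral_vg_pdf[OF m \<alpha>, where N = "\<lambda>u. Gamma (1/2 - c) * B u powr (c - 1/2)"])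
    show "has_bochner_integral lborel
      (\<lambda>x. of_real (x\<^sup>2) powr (- s) * of_real (exp (- (\<alpha>/2 * exp (- u) * x\<^sup>2))))
      (Gamma (1/2 - s) * of_real (B u) powr (s - 1/2))" for u
      using has_bochner_integral_gaussian_moment[OF s(1) B] unfolding B_def .
    have "norm (of_real (x\<^sup>2) powr (- s)) = (x\<^sup>2) powr (- c)" for x
      by (subst norm_powr_real_powr) (auto simp: c_def)
    then show "(\<integral>x. norm (of_real (x\<^sup>2) powr (- s)) * exp (- (\<alpha>/2 * exp (- u) * x\<^sup>2)) \<partial>lborel)
      = Gamma (1/2 - c) * B u powr (c - 1/2)" for u
      using has_bochner_integral_gaussian_moment_real[of c "B u"] B[of u] s
      by (simp add: B_def c_def has_bochner_integral_iff)
    show "integrable lborel (\<lambda>u. exp (m * u) * exp (- (\<alpha>/2 * exp u)) * (Gamma (1/2 - c) * B u powr (c - 1/2)))"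
      unfolding real using has_bochner_integral_Gamma_exp_real[of "m + 1/2 - c" "\<alpha>/2"] s \<alpha>
      by (intro integrable_mult_right) (simp add: has_bochner_integral_iff c_def)
  qed measurable
  also have "(\<integral>u. of_real (exp (m * u) * exp (- (\<alpha>/2 * exp u))) * (Gamma (1/2 - s) * of_real (B u) powr (s - 1/2)) \<partial>lborel)
     = Gamma (1/2 - s) * exp ((s - 1/2) * L) * (Gamma (of_real (m + 1/2) - s) * exp (- (of_real (m + 1/2) - s) * L))"
    unfolding cplx using has_bochner_integral_Gamma_exp[of "of_real (m + 1/2) - s" "\<alpha>/2"] s \<alpha>
    by (simp add: has_bochner_integral_iff of_real_powr_eq_exp L_def del: of_real_divide)
  also have "((\<alpha>/2) powr (m + 1) / (sqrt pi * Gamma (m + 1/2))) *\<^sub>R \<dots> =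
    of_real (\<alpha>\<^sup>2 / 4) powr s * Gamma (1/2 - s) * Gamma (of_real (m + 1/2) - s)
      / of_real (sqrt pi * Gamma (m + 1/2))"
  proof -
    have "\<alpha>\<^sup>2 / 4 = exp (2 * L)" by (simp only: exp_double a2 power_divide) simp
    then have 1: "of_real (\<alpha>\<^sup>2 / 4) powr s = exp (2 * s * L)"
      by (simp add: of_real_powr_eq_exp mult_ac del: of_real_exp)
    have 2: "of_real ((\<alpha>/2) powr (m + 1)) = exp (complex_of_real ((m + 1) * L))"
      using \<alpha> by (simp add: powr_def L_def flip: exp_of_real)
    have "exp (complex_of_real ((m + 1) * L)) * (exp ((s - 1/2) * L) * exp (- (of_real (m + 1/2) - s) * L)) = exp (2 * s * L)"
      by (simp add: algebra_simps flip: exp_add)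
    then show ?thesis unfolding 1
      by (simp add: scaleR_conv_of_real 2 mult_ac del: of_real_mult)
  qed
  finally show ?thesis .
qed

section \<open>Mellin-Barnes integrals\<close>

lemma norm_of_real_powr:
  "w \<ge> 0 \<Longrightarrow> norm (complex_of_real w powr z) = w powr Re z"
  by (subst norm_powr_real_powr) auto

lemma borel_measurable_Complex [measurable]: "Complex c \<in> borel_measurable borel"
  unfolding Complex_eq [abs_def] by measurable

text \<open>On the line Re s = c the modulus of W^(-s) is W^(-c), independent of y. The absolute
  double integral is thus a product of two single integrals. The integrability obtained as a
  by-product replaces decay estimates for products of Gamma functions.\<close>

lemma
  fixes f :: "real \<Rightarrow> complex" and W :: "real \<Rightarrow> real"
  assumes G: "integrable lborel G"
    and [measurable]: "f \<in> borel_measurable borel" "W \<in> borel_measurable borel"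
    and W: "\<And>x. W x \<ge> 0"
    and f: "integrable lborel (\<lambda>x. f x * of_real (W x powr (- c)))"
  shows integral_Mellin_swap:
      "(\<integral>x. f x * (\<integral>y. G y * of_real (W x) powr (- Complex c y) \<partial>lborel) \<partial>lborel) =
       (\<integral>y. G y * (\<integral>x. f x * of_real (W x) powr (- Complex c y) \<partial>lborel) \<partial>lborel)"
    and integrable_Mellin_swap:
      "integrable lborel (\<lambda>y. G y * (\<integral>x. f x * of_real (W x) powr (- Complex c y) \<partial>lborel))"
proof -
  let ?F = "\<lambda>y x. G y * (f x * of_real (W x) powr (- Complex c y))"
  have [measurable]: "G \<in> borel_measurable borel" using G by auto
  have n: "norm (f x * of_real (W x) powr (- Complex c y)) = norm (f x * of_real (W x powr (- c)))" for x y
    using W[of x] by (simp add: norm_mult norm_of_real_powr)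
  have int: "integrable (lborel \<Otimes>\<^sub>M lborel) (\<lambda>(y, x). ?F y x)"
  proof (rule lborel_pair.Fubini_integrable)
    show "integrable lborel (\<lambda>y. \<integral>x. norm (case (y, x) of (y, x) \<Rightarrow> ?F y x) \<partial>lborel)"
      unfolding prod.case norm_mult[of "G _"] n integral_mult_right_zero using G by simp
    have "integrable lborel (\<lambda>x. f x * of_real (W x) powr (- Complex c y))" for y
      using f by (rule Bochner_Integration.integrable_bound) (auto simp: n)
    then show "AE y in lborel. integrable lborel (\<lambda>x. case (y, x) of (y, x) \<Rightarrow> ?F y x)"
      by auto
  qed measurable
  show "integrable lborel (\<lambda>y. G y * (\<integral>x. f x * of_real (W x) powr (- Complex c y) \<partial>lborel))"
    using lborel_pair.integrable_fst[of ?F] int by simp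
  have "(\<integral>x. \<integral>y. ?F y x \<partial>lborel \<partial>lborel) = (\<integral>y. \<integral>x. ?F y x \<partial>lborel \<partial>lborel)"
    by (rule lborel_pair.Fubini_integral[OF int])
  moreover have "(\<integral>y. ?F y x \<partial>lborel) = f x * (\<integral>y. G y * of_real (W x) powr (- Complex c y) \<partial>lborel)" for x
    by (simp add: mult.left_commute flip: integral_mult_right_zero)
  ultimately show "(\<integral>x. f x * (\<integral>y. G y * of_real (W x) powr (- Complex c y) \<partial>lborel) \<partial>lborel) =
       (\<integral>y. G y * (\<integral>x. f x * of_real (W x) powr (- Complex c y) \<partial>lborel) \<partial>lborel)"
    by simp
qed

text \<open>Integrating (w exp v)^(-s) against exp (\<nu> v) exp (-exp v) produces w^(-s) Gamma
  (\<nu> - s). Exchanging the integrals leaves the Cahen-Mellin integral at w exp v, whose value exp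
  (-w exp v) raises the rate in Euler's integral from 1 to 1 + w.\<close>

lemma
  assumes c: "0 < c" "c < \<nu>"
  shows integrable_Gamma_Gamma_vertical:
      "integrable lborel (\<lambda>y. Gamma (Complex c y) * Gamma (of_real \<nu> - Complex c y))" (is "integrable lborel ?G")
    and Mellin_Barnes_binomial:
      "w > 0 \<Longrightarrow> (\<integral>y. Gamma (Complex c y) * Gamma (of_real \<nu> - Complex c y) * of_real w powr (- Complex c y) \<partial>lborel)
        = 2 * pi * of_real (Gamma \<nu> * (1 + w) powr (- \<nu>))"
proof -
  define f where "f v = complex_of_real (exp (\<nu> * v) * exp (- exp v))" for v
  have [measurable]: "f \<in> borel_measurable borel" unfolding f_def by measurable
  have f_int: "integrable lborel (\<lambda>v. f v * of_real ((w * exp v) powr (- c)))" if "w > 0" for w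
  proof -
    have "f v * of_real ((w * exp v) powr (- c)) =
        of_real (w powr (- c) * (exp ((\<nu> - c) * v) * exp (- (1 * exp v))))" for v
    proof -
      have "exp (\<nu> * v) * (w * exp v) powr (- c) = w powr (- c) * exp ((\<nu> - c) * v)"
        using that by (simp add: powr_def ln_mult algebra_simps flip: exp_add)
      then show ?thesis by (simp add: f_def mult_ac flip: of_real_mult)
    qed
    then show ?thesis
      using has_bochner_integral_Gamma_exp_real[of "\<nu> - c" 1] c
      by (simp add: has_bochner_integral_iff complex_of_real_integrable_eq del: of_real_mult)
  qed
  have inner: "(\<integral>v. f v * of_real (w * exp v) powr (- Complex c y) \<partial>lborel) =
      of_real w powr (- Complex c y) * Gamma (of_real \<nu> - Complex c y)" if "w > 0" for w y
  proof -
    have "f v * of_real (w * exp v) powr (- Complex c y) = of_real w powr (- Complex c y) *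
        (exp ((of_real \<nu> - Complex c y) * of_real v) * of_real (exp (- (1 * exp v))))" for v
    proof -
      have "of_real (exp (\<nu> * v)) * of_real (w * exp v) powr (- Complex c y) =
          of_real w powr (- Complex c y) * exp ((of_real \<nu> - Complex c y) * of_real v)"
        using that by (simp add: of_real_powr_eq_exp ln_mult algebra_simps del: of_real_mult flip: exp_add exp_of_real)
          (simp add: algebra_simps)
      then show ?thesis unfolding f_def of_real_mult[of "exp (\<nu> * v)"] mult_1_left by algebra
    qed
    then show ?thesis
      using has_bochner_integral_Gamma_exp[of "of_real \<nu> - Complex c y" 1] c
      by (simp add: has_bochner_integral_iff)
  qed
  note swap = integrable_Gamma_vertical[OF c(1)] \<open>f \<in> borel_measurable borel\<close>
  \<comment> \<open>Integrability is the case w = 1, where the power of w disappears.\<close>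
  have "integrable lborel (\<lambda>y. Gamma (Complex c y) *
      (\<integral>v. f v * of_real (1 * exp v) powr (- Complex c y) \<partial>lborel))"
    by (rule integrable_Mellin_swap[OF swap _ _ f_int]) auto
  then show "integrable lborel ?G" by (subst (asm) inner) simp_all
  assume w: "w > 0"
  have "(\<integral>y. ?G y * of_real w powr (- Complex c y) \<partial>lborel) =
      (\<integral>y. Gamma (Complex c y) * (\<integral>v. f v * of_real (w * exp v) powr (- Complex c y) \<partial>lborel) \<partial>lborel)"
    by (simp only: inner[OF w] mult_ac)
  also have "\<dots> = (\<integral>v. f v * (\<integral>y. Gamma (Complex c y) * of_real (w * exp v) powr (- Complex c y) \<partial>lborel) \<partial>lborel)"
    by (rule integral_Mellin_swap[OF swap _ _ f_int, symmetric]) (use w in auto)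
  also have "\<dots> = (\<integral>v. of_real (2 * pi * (exp (\<nu> * v) * exp (- ((1 + w) * exp v)))) \<partial>lborel)"
  proof (rule Bochner_Integration.integral_cong)
    fix v
    have "exp (- exp v) * exp (- (w * exp v)) = exp (- ((1 + w) * exp v))"
      by (simp add: algebra_simps flip: exp_add)
    moreover have "f v * (\<integral>y. Gamma (Complex c y) * of_real (w * exp v) powr (- Complex c y) \<partial>lborel) =
        of_real (2 * pi * (exp (\<nu> * v) * (exp (- exp v) * exp (- (w * exp v)))))"
      using w by (subst Cahen_Mellin[OF c(1)]) (auto simp: f_def simp del: of_real_exp)
    ultimately show "f v * (\<integral>y. Gamma (Complex c y) * of_real (w * exp v) powr (- Complex c y) \<partial>lborel) =
        of_real (2 * pi * (exp (\<nu> * v) * exp (- ((1 + w) * exp v))))"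
      by simp
  qed simp
  also have "\<dots> = of_real (2 * pi * (Gamma \<nu> * (1 + w) powr (- \<nu>)))"
    using has_bochner_integral_Gamma_exp_real[of \<nu> "1 + w"] c w
    by (simp add: has_bochner_integral_iff del: of_real_mult)
  finally show "(\<integral>y. ?G y * of_real w powr (- Complex c y) \<partial>lborel) = 2 * pi * of_real (Gamma \<nu> * (1 + w) powr (- \<nu>))"
    by simp
qed

text \<open>The binomial formula at w = (t r / \<alpha>2)^2 is inserted for each r, and the exchange
  leaves a moment of the first density. Proving this for all c in the strip gives line integrals
  with one common value, so no contour has to be shifted.\<close>

lemma vg_char_integral_Mellin_Barnes:
  fixes m n \<alpha>1 \<alpha>2 c t :: real
  assumes m: "m > -1/2" and n: "n > -1/2" and \<alpha>: "\<alpha>1 > 0" "\<alpha>2 > 0" and t: "t \<noteq> 0"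
    and c: "0 < c" "c < 1/2" "c < m + 1/2" "c < n + 1/2"
  defines "x \<equiv> \<alpha>1\<^sup>2 * \<alpha>2\<^sup>2 / (4 * t\<^sup>2)"
  defines "g \<equiv> \<lambda>s. Gamma (1/2 - s) * Gamma (of_real (m + 1/2) - s) * Gamma (of_real (n + 1/2) - s)
    * Gamma s * of_real x powr s"
  shows "integrable lborel (\<lambda>y. g (Complex c y))"
    and "(\<integral>r. vg_pdf m \<alpha>1 0 r *\<^sub>R of_real ((1 + (t * r)\<^sup>2 / \<alpha>2\<^sup>2) powr (- (n + 1/2))) \<partial>lborel) =
      of_real (1 / (sqrt pi * Gamma (m + 1/2) * Gamma (n + 1/2))) *
      ((\<integral>y. g (Complex c y) \<partial>lborel) / (2 * pi))"
proof -
  define f where "f r = complex_of_real (vg_pdf m \<alpha>1 0 r)" for r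
  define b where "b = t\<^sup>2 / \<alpha>2\<^sup>2"
  define W where "W r = b * r\<^sup>2" for r :: real
  define G where "G y = Gamma (Complex c y) * Gamma (of_real (n + 1/2) - Complex c y)" for y
  define C where "C = sqrt pi * Gamma (m + 1/2)"
  have b: "b > 0" using t \<alpha> by (simp add: b_def)
  have C: "C > 0" using m by (simp add: C_def)
  have gn: "Gamma (n + 1/2) > 0" using n by simp
  have [measurable]: "f \<in> borel_measurable borel" "W \<in> borel_measurable borel"
    using borel_measurable_vg_pdf[OF m \<alpha>(1)] unfolding f_def W_def by measurable
  have G: "integrable lborel G"
    unfolding G_def using c by (intro integrable_Gamma_Gamma_vertical)
  then have [measurable]: "G \<in> borel_measurable borel" by auto
  \<comment> \<open>At r = 0 both sides vanish because a power of base 0 is 0 by convention.\<close>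
  have powr_W: "of_real (W r) powr (- s) = of_real b powr (- s) * of_real (r\<^sup>2) powr (- s)" for r and s :: complex
    using b by (cases "r = 0") (simp_all add: W_def of_real_powr_eq_exp ln_mult ring_distribs
      del: of_real_mult of_real_power flip: exp_add)
  have moment: "has_bochner_integral lborel (\<lambda>r. f r * of_real (W r) powr (- s))
      (of_real b powr (- s) * (of_real (\<alpha>1\<^sup>2 / 4) powr s * Gamma (1/2 - s) * Gamma (of_real (m + 1/2) - s) / of_real C))"
    if "Re s = c" for s
  proof -
    have "f r * of_real (W r) powr (- s) =
        of_real b powr (- s) * (vg_pdf m \<alpha>1 0 r *\<^sub>R of_real (r\<^sup>2) powr (- s))" for r
      by (simp only: f_def powr_W scaleR_conv_of_real mult_ac)
    then show ?thesis
      unfolding C_def using c that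
      by (simp only:) (intro has_bochner_integral_mult_right has_bochner_integral_vg_pdf_moment m \<alpha>; simp)
  qed
  have "of_real (W r) powr (- of_real c) = complex_of_real (W r powr (- c))" for r
    using b by (simp add: W_def powr_of_real [symmetric])
  then have f_int: "integrable lborel (\<lambda>r. f r * of_real (W r powr (- c)))"
    using moment[of "of_real c"] by (simp add: has_bochner_integral_iff)
  \<comment> \<open>Here the argument of the G-function arises: x is (\<alpha>1^2 / 4) / b, the
    scale of the moments divided by the scale of W.\<close>
  have x_powr: "of_real b powr (- s) * of_real (\<alpha>1\<^sup>2 / 4) powr s = of_real x powr s" for s :: complex
  proof -
    have x: "x > 0" "x * b = \<alpha>1\<^sup>2 / 4" using \<alpha> t by (simp_all add: x_def b_def)
    have ln_x: "ln x = ln (\<alpha>1\<^sup>2 / 4) - ln b"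
      unfolding x(2) [symmetric] using x(1) b by (simp add: ln_mult)
    show ?thesis
      using b \<alpha> x(1)
      by (simp add: of_real_powr_eq_exp ln_x ring_distribs del: of_real_divide of_real_power flip: exp_add)
  qed
  have inner: "G y * (\<integral>r. f r * of_real (W r) powr (- Complex c y) \<partial>lborel) = g (Complex c y) / of_real C" for y
    using moment[of "Complex c y"]
    by (simp add: has_bochner_integral_iff G_def g_def x_powr [symmetric])
  have swap: "integrable lborel (\<lambda>y. G y * (\<integral>r. f r * of_real (W r) powr (- Complex c y) \<partial>lborel))"
    "(\<integral>r. f r * (\<integral>y. G y * of_real (W r) powr (- Complex c y) \<partial>lborel) \<partial>lborel) =
       (\<integral>y. G y * (\<integral>r. f r * of_real (W r) powr (- Complex c y) \<partial>lborel) \<partial>lborel)"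
    using b by (intro integrable_Mellin_swap integral_Mellin_swap G f_int; simp add: W_def)+
  show gi: "integrable lborel (\<lambda>y. g (Complex c y))"
    using integrable_mult_right[OF swap(1), of "of_real C"] C unfolding inner by simp
  \<comment> \<open>The binomial formula requires W r > 0, which excludes exactly r = 0.\<close>
  have "AE r in lborel. vg_pdf m \<alpha>1 0 r *\<^sub>R of_real ((1 + (t * r)\<^sup>2 / \<alpha>2\<^sup>2) powr (- (n + 1/2))) =
      f r * (\<integral>y. G y * of_real (W r) powr (- Complex c y) \<partial>lborel) / of_real (2 * pi * Gamma (n + 1/2))"
    using AE_lborel_singleton[of 0]
  proof eventually_elim
    case (elim r)
    have "W r > 0" using elim b by (simp add: W_def)
    then have "(\<integral>y. G y * of_real (W r) powr (- Complex c y) \<partial>lborel) =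
        2 * pi * of_real (Gamma (n + 1/2) * (1 + W r) powr (- (n + 1/2)))"
      unfolding G_def using c by (intro Mellin_Barnes_binomial) auto
    moreover have "W r = (t * r)\<^sup>2 / \<alpha>2\<^sup>2" by (simp add: W_def b_def power_mult_distrib)
    ultimately show ?case using gn by (simp add: f_def scaleR_conv_of_real)
  qed
  moreover have "(\<lambda>r. vg_pdf m \<alpha>1 0 r *\<^sub>R complex_of_real ((1 + (t * r)\<^sup>2 / \<alpha>2\<^sup>2) powr (- (n + 1/2)))) \<in> borel_measurable lborel"
    using borel_measurable_vg_pdf[OF m \<alpha>(1)] by measurable
  moreover have "(\<lambda>r. f r * (\<integral>y. G y * of_real (W r) powr (- Complex c y) \<partial>lborel) / of_real (2 * pi * Gamma (n + 1/2))) \<in> borel_measurable lborel"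
    by measurable
  ultimately have "(\<integral>r. vg_pdf m \<alpha>1 0 r *\<^sub>R of_real ((1 + (t * r)\<^sup>2 / \<alpha>2\<^sup>2) powr (- (n + 1/2))) \<partial>lborel) =
      (\<integral>r. f r * (\<integral>y. G y * of_real (W r) powr (- Complex c y) \<partial>lborel) / of_real (2 * pi * Gamma (n + 1/2)) \<partial>lborel)"
    by (intro integral_cong_AE)
  also have "\<dots> = (\<integral>y. g (Complex c y) / of_real C \<partial>lborel) / of_real (2 * pi * Gamma (n + 1/2))"
    by (simp only: integral_divide_zero swap(2) inner)
  also have "\<dots> = of_real (1 / (sqrt pi * Gamma (m + 1/2) * Gamma (n + 1/2))) * ((\<integral>y. g (Complex c y) \<partial>lborel) / (2 * pi))"
    by (simp add: C_def)
  finally show "(\<integral>r. vg_pdf m \<alpha>1 0 r *\<^sub>R of_real ((1 + (t * r)\<^sup>2 / \<alpha>2\<^sup>2) powr (- (n + 1/2))) \<partial>lborel) =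
      of_real (1 / (sqrt pi * Gamma (m + 1/2) * Gamma (n + 1/2))) * ((\<integral>y. g (Complex c y) \<partial>lborel) / (2 * pi))" .
qed

section \<open>The Meijer G-function and the characteristic function of the product\<close>

lemma meijerG_integrand_3_1:
  "meijerG_integrand 3 1 [a] [b1, b2, b3] x s =
    Gamma (of_real b1 - s) * Gamma (of_real b2 - s) * Gamma (of_real b3 - s)
      * Gamma (1 - of_real a + s) * of_real x powr s"
  by (simp add: meijerG_integrand_def numeral_3_eq_3 lessThan_Suc mult_ac)

text \<open>The abscissa in \<open>meijerG\<close> is chosen by \<open>SOME\<close>, so the line integral must be known for every
  admissible one.\<close>
lemma meijerG_3_1_eqI:
  assumes sep: "a - 1 < b1" "a - 1 < b2" "a - 1 < b3"
    and int: "\<And>c. a - 1 < c \<Longrightarrow> c < b1 \<Longrightarrow> c < b2 \<Longrightarrow> c < b3 \<Longrightarrow>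
      has_bochner_integral lborel (\<lambda>y. meijerG_integrand 3 1 [a] [b1, b2, b3] x (Complex c y)) I"
  shows "meijerG 3 1 [a] [b1, b2, b3] x = I / (2 * pi)"
proof -
  let ?P = "\<lambda>c::real. (\<forall>j<3. c < [b1, b2, b3] ! j) \<and> (\<forall>j<1. [a] ! j - 1 < c)"
  have P_iff: "?P c \<longleftrightarrow> c < b1 \<and> c < b2 \<and> c < b3 \<and> a - 1 < c" for c
    by (auto simp: numeral_3_eq_3 less_Suc_eq)
  have "\<exists>c. ?P c" unfolding P_iff using dense[of "a - 1" "Min {b1, b2, b3}"] sep by auto
  then have "?P (SOME c. ?P c)" by (rule someI_ex)
  then have "has_bochner_integral lborel
      (\<lambda>y. meijerG_integrand 3 1 [a] [b1, b2, b3] x (Complex (SOME c. ?P c) y)) I"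
    unfolding P_iff by (intro int) auto
  then show ?thesis
    unfolding meijerG_def Let_def by (simp add: has_bochner_integral_iff integral_lborel)
qed

text \<open>Independence makes the joint law a product measure. For fixed X = x the inner integral
  is the characteristic function of Y at t x.\<close>

lemma char_product_vg:
  fixes M :: "'a measure" and X Y :: "'a \<Rightarrow> real"
  assumes M: "prob_space M"
    and mn: "m > -1/2" "n > -1/2" and \<alpha>: "\<alpha>1 > 0" "\<alpha>2 > 0"
    and X: "distributed M lborel X (\<lambda>x. ennreal (vg_pdf m \<alpha>1 0 x))"
    and Y: "distributed M lborel Y (\<lambda>x. ennreal (vg_pdf n \<alpha>2 0 x))"
    and indep: "prob_space.indep_var M borel X borel Y"
  shows "char (distr M borel (\<lambda>\<omega>. X \<omega> * Y \<omega>)) t =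
    (\<integral>x. vg_pdf m \<alpha>1 0 x *\<^sub>R of_real ((1 + (t * x)\<^sup>2 / \<alpha>2\<^sup>2) powr (- (n + 1/2))) \<partial>lborel)"
proof -
  interpret prob_space M by fact
  have [measurable]: "X \<in> borel_measurable M" "Y \<in> borel_measurable M"
    using X Y by (auto dest: distributed_measurable)
  interpret PX: prob_space "distr M borel X" by (rule prob_space_distr) simp
  interpret PY: prob_space "distr M borel Y" by (rule prob_space_distr) simp
  interpret PXY: pair_prob_space "distr M borel X" "distr M borel Y" ..
  \<comment> \<open>\<open>distributed\<close> speaks of the law on \<open>lborel\<close>,
    \<open>char\<close> of the law on \<open>borel\<close>; the two share their measurable sets.
    Nonnegativity of the density is known off 0, and almost everywhere is enough for
    \<open>integral_density\<close>.\<close>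
  have integral_vg: "(\<integral>x. h x \<partial>distr M borel Z) = (\<integral>x. vg_pdf k a 0 x *\<^sub>R h x \<partial>lborel)"
    if "distributed M lborel Z (\<lambda>x. ennreal (vg_pdf k a 0 x))" "k > -1/2" "a > 0"
      and [measurable]: "h \<in> borel_measurable borel" for Z k a and h :: "real \<Rightarrow> complex"
  proof -
    have "distr M borel Z = distr M lborel Z" by (rule distr_cong) auto
    also have "\<dots> = density lborel (\<lambda>x. ennreal (vg_pdf k a 0 x))"
      by (rule distributed_distr_eq_density[OF that(1)])
    finally have "(\<integral>x. h x \<partial>distr M borel Z) = (\<integral>x. h x \<partial>density lborel (\<lambda>x. ennreal (vg_pdf k a 0 x)))"
      by simp
    also have "\<dots> = (\<integral>x. vg_pdf k a 0 x *\<^sub>R h x \<partial>lborel)"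
      using borel_measurable_vg_pdf[OF that(2,3)] vg_pdf_nonneg[OF that(2,3)] AE_lborel_singleton[of 0]
      by (intro integral_density) (auto elim!: eventually_mono)
    finally show ?thesis .
  qed
  let ?e = "\<lambda>(x, y). iexp (t * (x * y))"
  have e: "integrable (distr M borel X \<Otimes>\<^sub>M distr M borel Y) ?e"
    by (rule PXY.integrable_const_bound[of _ 1]) (auto simp: split_beta')
  have "char (distr M borel (\<lambda>\<omega>. X \<omega> * Y \<omega>)) t = (\<integral>\<omega>. ?e (X \<omega>, Y \<omega>) \<partial>M)"
    unfolding char_def by (subst integral_distr) auto
  also have "\<dots> = (\<integral>p. ?e p \<partial>distr M (borel \<Otimes>\<^sub>M borel) (\<lambda>\<omega>. (X \<omega>, Y \<omega>)))"
    by (subst integral_distr) auto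
  also have "distr M (borel \<Otimes>\<^sub>M borel) (\<lambda>\<omega>. (X \<omega>, Y \<omega>)) = distr M borel X \<Otimes>\<^sub>M distr M borel Y"
    using indep by (simp add: indep_var_distribution_eq)
  also have "(\<integral>p. ?e p \<partial>(distr M borel X \<Otimes>\<^sub>M distr M borel Y)) =
      (\<integral>x. \<integral>y. iexp (t * (x * y)) \<partial>distr M borel Y \<partial>distr M borel X)"
    using PXY.integral_fst'[OF e] by simp
  also have "\<dots> = (\<integral>x. of_real ((1 + (t * x)\<^sup>2 / \<alpha>2\<^sup>2) powr (- (n + 1/2))) \<partial>distr M borel X)"
  proof (rule Bochner_Integration.integral_cong)
    fix x
    have "(\<integral>y. iexp (t * (x * y)) \<partial>distr M borel Y) = (\<integral>y. vg_pdf n \<alpha>2 0 y *\<^sub>R iexp (t * x * y) \<partial>lborel)"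
      by (subst integral_vg[OF Y mn(2) \<alpha>(2)]) (simp_all add: mult.assoc)
    also have "\<dots> = of_real ((1 + (t * x)\<^sup>2 / \<alpha>2\<^sup>2) powr (- (n + 1/2)))"
      using has_bochner_integral_vg_pdf_iexp[OF mn(2) \<alpha>(2)] by (simp only: has_bochner_integral_iff)
    finally show "(\<integral>y. iexp (t * (x * y)) \<partial>distr M borel Y) = of_real ((1 + (t * x)\<^sup>2 / \<alpha>2\<^sup>2) powr (- (n + 1/2)))" .
  qed simp
  also have "\<dots> = (\<integral>x. vg_pdf m \<alpha>1 0 x *\<^sub>R of_real ((1 + (t * x)\<^sup>2 / \<alpha>2\<^sup>2) powr (- (n + 1/2))) \<partial>lborel)"
    by (rule integral_vg[OF X mn(1) \<alpha>(1)]) measurable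
  finally show ?thesis .
qed

theorem mainTheorem6:
  fixes M :: "'a measure" and X Y :: "'a \<Rightarrow> real" and m n \<alpha>1 \<alpha>2 :: real
  assumes "prob_space M"
    and "m > -1/2" and "n > -1/2" and "\<alpha>1 > 0" and "\<alpha>2 > 0"
    and "distributed M lborel X (\<lambda>x. ennreal (vg_pdf m \<alpha>1 0 x))"
    and "distributed M lborel Y (\<lambda>x. ennreal (vg_pdf n \<alpha>2 0 x))"
    and "prob_space.indep_var M borel X borel Y"
  shows "\<forall>t::real. t \<noteq> 0 \<longrightarrow>
    char (distr M borel (\<lambda>\<omega>. X \<omega> * Y \<omega>)) t =
      of_real (\<alpha>1 * \<alpha>2 / (2 * sqrt pi * Gamma (m + 1/2) * Gamma (n + 1/2)) * \<bar>t\<bar> powr (-1))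
      * meijerG 3 1 [1/2] [0, m, n] (\<alpha>1\<^sup>2 * \<alpha>2\<^sup>2 / (4 * t\<^sup>2))
    \<and> char (distr M borel (\<lambda>\<omega>. X \<omega> * Y \<omega>)) t =
      of_real (1 / (sqrt pi * Gamma (m + 1/2) * Gamma (n + 1/2)))
      * meijerG 3 1 [1] [1/2, m + 1/2, n + 1/2] (\<alpha>1\<^sup>2 * \<alpha>2\<^sup>2 / (4 * t\<^sup>2))"
proof (intro allI impI)
  fix t :: real assume t: "t \<noteq> 0"
  define x where "x = \<alpha>1\<^sup>2 * \<alpha>2\<^sup>2 / (4 * t\<^sup>2)"
  define \<phi> where "\<phi> = char (distr M borel (\<lambda>\<omega>. X \<omega> * Y \<omega>)) t"
  define C where "C = sqrt pi * Gamma (m + 1/2) * Gamma (n + 1/2)"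
  \<comment> \<open>The positive square root of x. It is the factor x^(1/2) released when s moves by
    1/2, and it accounts for the different prefactors of the two formulas.\<close>
  define q where "q = \<alpha>1 * \<alpha>2 / (2 * \<bar>t\<bar>)"
  have C: "C > 0" unfolding C_def using assms by (intro mult_pos_pos Gamma_real_pos) auto
  have q: "q > 0" "x = q\<^sup>2"
    using assms t by (simp_all add: q_def x_def power_divide power_mult_distrib)
  \<comment> \<open>The value is expressed through \<phi> alone, so it is the same on every
    admissible line, as \<open>meijerG_3_1_eqI\<close> demands.\<close>
  have second: "has_bochner_integral lborel
      (\<lambda>y. meijerG_integrand 3 1 [1] [1/2, m + 1/2, n + 1/2] x (Complex c y)) (2 * pi * (of_real C * \<phi>))"
    if c: "0 < c" "c < 1/2" "c < m + 1/2" "c < n + 1/2" for c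
  proof -
    define I where "I = (\<integral>y. meijerG_integrand 3 1 [1] [1/2, m + 1/2, n + 1/2] x (Complex c y) \<partial>lborel)"
    have eq: "meijerG_integrand 3 1 [1] [1/2, m + 1/2, n + 1/2] x s =
        Gamma (1/2 - s) * Gamma (of_real (m + 1/2) - s) * Gamma (of_real (n + 1/2) - s) * Gamma s * of_real x powr s" for s
      unfolding meijerG_integrand_3_1 by simp
    note MB = vg_char_integral_Mellin_Barnes[OF assms(2-5) t c, folded x_def, folded eq C_def]
    have "\<phi> = of_real (1 / C) * (I / (2 * pi))"
      using MB(2) char_product_vg[OF assms, of t] unfolding \<phi>_def I_def by simp
    then have "I = 2 * pi * (of_real C * \<phi>)" using C by simp
    with MB(1) show ?thesis unfolding I_def by (simp add: has_bochner_integral_iff)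
  qed
  \<comment> \<open>Adding 1/2 to s lowers every lower parameter and the upper one by 1/2. The strip
    from -1/2 to the minimum of 0, m, n is thereby carried onto the strip of
    \<open>second\<close>.\<close>
  have shift: "meijerG_integrand 3 1 [1/2] [0, m, n] x (Complex c y) =
      of_real (inverse q) * meijerG_integrand 3 1 [1] [1/2, m + 1/2, n + 1/2] x (Complex (c + 1/2) y)" for c y
  proof -
    have s: "Complex (c + 1/2) y = Complex c y + 1/2" by (simp add: complex_eq_iff)
    have "of_real x powr (Complex c y + 1/2) = of_real q * of_real x powr Complex c y"
    proof -
      have "ln x = 2 * ln q" using q by (simp add: ln_realpow)
      then have "of_real x powr (1/2 :: complex) = of_real q"
        using q(1) q(2) by (simp add: of_real_powr_eq_exp del: of_real_power) (simp add: exp_of_real)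
      then show ?thesis by (simp add: powr_add)
    qed
    then show ?thesis unfolding meijerG_integrand_3_1 s using q(1) by (simp add: algebra_simps)
  qed
  have first: "has_bochner_integral lborel
      (\<lambda>y. meijerG_integrand 3 1 [1/2] [0, m, n] x (Complex c y)) (of_real (inverse q) * (2 * pi * (of_real C * \<phi>)))"
    if c: "1/2 - 1 < c" "c < 0" "c < m" "c < n" for c
    unfolding shift using c by (intro has_bochner_integral_mult_right second) auto
  have "meijerG 3 1 [1/2] [0, m, n] x = of_real (inverse q) * (2 * pi * (of_real C * \<phi>)) / (2 * pi)"
    using assms by (intro meijerG_3_1_eqI first) auto
  moreover have "meijerG 3 1 [1] [1/2, m + 1/2, n + 1/2] x = 2 * pi * (of_real C * \<phi>) / (2 * pi)"
    using assms by (intro meijerG_3_1_eqI second) auto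
  moreover have "\<alpha>1 * \<alpha>2 / (2 * sqrt pi * Gamma (m + 1/2) * Gamma (n + 1/2)) * \<bar>t\<bar> powr (-1) = q / C"
    using t by (simp add: q_def C_def powr_minus field_simps)
  ultimately show "char (distr M borel (\<lambda>\<omega>. X \<omega> * Y \<omega>)) t = of_real (\<alpha>1 * \<alpha>2 / (2 * sqrt pi * Gamma (m + 1/2) * Gamma (n + 1/2)) * \<bar>t\<bar> powr (-1))
      * meijerG 3 1 [1/2] [0, m, n] (\<alpha>1\<^sup>2 * \<alpha>2\<^sup>2 / (4 * t\<^sup>2))
    \<and> char (distr M borel (\<lambda>\<omega>. X \<omega> * Y \<omega>)) t = of_real (1 / (sqrt pi * Gamma (m + 1/2) * Gamma (n + 1/2)))
      * meijerG 3 1 [1] [1/2, m + 1/2, n + 1/2] (\<alpha>1\<^sup>2 * \<alpha>2\<^sup>2 / (4 * t\<^sup>2))"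
    using q(1) C by (simp add: C_def [symmetric] x_def [symmetric] \<phi>_def [symmetric])
qed

end
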